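(* Let $\Theta$ be a variety of $\Omega$-groups and let $H$ be a non-trivial $\Omega$-group in $\Theta$. Then $H$ is an equational domain in $\Theta$ if and only if $H$ is C-anticommutative.
   Context: **$\Omega$-groups.** An $\Omega$-group is an additive group $G$ (not necessarily commutative) with an additional signature $\Omega$ of operations, such that every $\omega\in\Omega$ has arity $n=n(\omega)>0$ and satisfies $\underbrace{00\cdots 0}_{n}\,\omega=0$ (operations are written on the right of their arguments). For fixed $\Omega$, the class of all $\Omega$-groups is a variety $\Upsilon$; a variety $\Theta$ of $\Omega$-groups is a subvariety of $\Upsilon$. An $\Omega$-subgroup is a subgroup of the additive group closed under all $\omega\in\Omega$. "Non-trivial" means different from $\{0\}$. **Ideals.** For tuples $\bar a=(a_1,\dots,a_n)$, $\bar b=(b_1,\dots,b_n)$ put $\bar a+\bar b=(a_1+b_1,\dots,a_n+b_n)$, and for $\omega\in\Omega$ of arity $n$ let $[\bar a;\bar b;\omega]=-\bar a\omega-\bar b\omega+(\bar a+\bar b)\omega$. A subset $U\subseteq G$ is an ideal of $G$ if: (1) $U$ is closed under all $\omega\in\Omega$; (2) $U$ is a normal subgroup of the additive group of $G$; (3) $[\bar a;\bar b;\omega]\in U$ for all $\omega\in\Omega$, all tuples $\bar a$ of elements of $U$ and all tuples $\bar b$ of elements of $G$. **Commutator group.** Let $f(\bar x,\bar y)$ be a word in two finite disjoint tuples of variables $\bar x,\bar y$, i.e. an element of the free $\Omega$-group on these variables in $\Upsilon$. It is a commutator word in $\bar x$ and $\bar y$ if $f(\bar x,\bar 0)=f(\bar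 0,\bar y)=0$. For subsets $A,B$ of an $\Omega$-group $G$, $[A,B]$ is the set of all elements $f(\bar a,\bar b)$, where $f(\bar x,\bar y)$ is a commutator word in $\bar x$ and $\bar y$ and $\bar a,\bar b$ are tuples of elements of $A$, $B$ respectively. Write $[A,B]=0$ if this set consists of $0$ only. An $\Omega$-group $G$ is abelian if $[G,G]=0$. **Anticommutativity.** An $\Omega$-group $L$ is anticommutative if (1) $L$ has no non-trivial abelian ideal, and (2) every two non-trivial ideals of $L$ have a non-trivial intersection. An $\Omega$-group $H$ is C-anticommutative (completely anticommutative) if each of its nonzero $\Omega$-subgroups is anticommutative. **Equational domain.** Let $F(X)$ be the free $\Omega$-group in $\Theta$ on a finite set $X$. A subset $A\subseteq\mathrm{Hom}(F(X),H)$ is an (affine) algebraic variety over $H$ if there is a subset $T\subseteq F(X)$ with $A=\{\mu\in\mathrm{Hom}(F(X),H) : T\subseteq\mathrm{Ker}\,\mu\}$. The $\Omega$-group $H$ is an equational domain in $\Theta$ if for every finite set $X$ and any two algebraic varieties $A,B\subseteq\mathrm{Hom}(F(X),H)$, the union $A\cup B$ is also an algebraic variety. *)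

theory Defs
  imports "HOL-Algebra.Coset"
begin

section \<open>Omega-groups\<close>

record 'w signature =
  ops :: "'w set"
  arity :: "'w \<Rightarrow> nat"

text \<open>The additive, not necessarily commutative, group of an \<open>\<Omega>\<close>-group is a group in the sense of
  \<open>HOL-Algebra\<close> and hence written multiplicatively: \<open>x \<otimes> y\<close>, \<open>\<one>\<close> and \<open>inv x\<close> stand for
  \<open>x + y\<close>, \<open>0\<close> and \<open>-x\<close>.  An operation of arity \<open>n\<close> takes its arguments as a list of length \<open>n\<close>.\<close>

record ('a, 'w) ogroup = "'a monoid" +
  opn :: "'w \<Rightarrow> 'a list \<Rightarrow> 'a"

definition tuples :: "nat \<Rightarrow> 'a set \<Rightarrow> 'a list set" where
  "tuples n A = {as. length as = n \<and> set as \<subseteq> A}"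

locale omega_group = group G for S :: "'w signature" and G :: "('a, 'w, 'm) ogroup_scheme" (structure) +
  assumes arity_pos: "w \<in> ops S \<Longrightarrow> 0 < arity S w"
    and opn_closed: "w \<in> ops S \<Longrightarrow> as \<in> tuples (arity S w) (carrier G) \<Longrightarrow> opn G w as \<in> carrier G"
    and opn_one: "w \<in> ops S \<Longrightarrow> opn G w (replicate (arity S w) \<one>) = \<one>"

definition omega_closed :: "'w signature \<Rightarrow> 'a set \<Rightarrow> ('a, 'w, 'm) ogroup_scheme \<Rightarrow> bool" where
  "omega_closed S U G \<longleftrightarrow> (\<forall>w \<in> ops S. \<forall>as \<in> tuples (arity S w) U. opn G w as \<in> U)"

definition omega_subgroup :: "'w signature \<Rightarrow> 'a set \<Rightarrow> ('a, 'w, 'm) ogroup_scheme \<Rightarrow> bool" where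
  "omega_subgroup S U G \<longleftrightarrow> subgroup U G \<and> omega_closed S U G"

definition bracket :: "('a, 'w, 'm) ogroup_scheme \<Rightarrow> 'a list \<Rightarrow> 'a list \<Rightarrow> 'w \<Rightarrow> 'a" where
  "bracket G as bs w =
     inv\<^bsub>G\<^esub> (opn G w as) \<otimes>\<^bsub>G\<^esub> inv\<^bsub>G\<^esub> (opn G w bs) \<otimes>\<^bsub>G\<^esub> opn G w (map2 (\<lambda>a b. a \<otimes>\<^bsub>G\<^esub> b) as bs)"

definition omega_ideal :: "'w signature \<Rightarrow> 'a set \<Rightarrow> ('a, 'w, 'm) ogroup_scheme \<Rightarrow> bool" where
  "omega_ideal S U G \<longleftrightarrow> omega_closed S U G \<and> U \<lhd> G \<and>
     (\<forall>w \<in> ops S. \<forall>as \<in> tuples (arity S w) U. \<forall>bs \<in> tuples (arity S w) (carrier G).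
        bracket G as bs w \<in> U)"

definition omega_hom ::
  "'w signature \<Rightarrow> ('a, 'w, 'm) ogroup_scheme \<Rightarrow> ('b, 'w, 'k) ogroup_scheme \<Rightarrow> ('a \<Rightarrow> 'b) set" where
  "omega_hom S G H = {\<mu> \<in> carrier G \<rightarrow>\<^sub>E carrier H. \<mu> \<in> hom G H \<and>
     (\<forall>w \<in> ops S. \<forall>as \<in> tuples (arity S w) (carrier G). \<mu> (opn G w as) = opn H w (map \<mu> as))}"


section \<open>Varieties and free Omega-groups\<close>

datatype ('x, 'w) expr =
  Var 'x | Zero | Neg "('x, 'w) expr" | Add "('x, 'w) expr" "('x, 'w) expr" | App 'w "('x, 'w) expr list"

inductive_set exprs :: "'w signature \<Rightarrow> 'x set \<Rightarrow> ('x, 'w) expr set"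
  for S :: "'w signature" and X :: "'x set" where
  Var: "x \<in> X \<Longrightarrow> Var x \<in> exprs S X"
| Zero: "Zero \<in> exprs S X"
| Neg: "s \<in> exprs S X \<Longrightarrow> Neg s \<in> exprs S X"
| Add: "s \<in> exprs S X \<Longrightarrow> t \<in> exprs S X \<Longrightarrow> Add s t \<in> exprs S X"
| App: "w \<in> ops S \<Longrightarrow> length ts = arity S w \<Longrightarrow> \<forall>t \<in> set ts. t \<in> exprs S X \<Longrightarrow> App w ts \<in> exprs S X"

primrec eval :: "('a, 'w, 'm) ogroup_scheme \<Rightarrow> ('x \<Rightarrow> 'a) \<Rightarrow> ('x, 'w) expr \<Rightarrow> 'a" where
  "eval G v (Var x) = v x"
| "eval G v Zero = \<one>\<^bsub>G\<^esub>"
| "eval G v (Neg s) = inv\<^bsub>G\<^esub> (eval G v s)"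
| "eval G v (Add s t) = eval G v s \<otimes>\<^bsub>G\<^esub> eval G v t"
| "eval G v (App w ts) = opn G w (map (eval G v) ts)"

primrec subst :: "('x \<Rightarrow> ('y, 'w) expr) \<Rightarrow> ('x, 'w) expr \<Rightarrow> ('y, 'w) expr" where
  "subst \<sigma> (Var x) = \<sigma> x"
| "subst \<sigma> Zero = Zero"
| "subst \<sigma> (Neg s) = Neg (subst \<sigma> s)"
| "subst \<sigma> (Add s t) = Add (subst \<sigma> s) (subst \<sigma> t)"
| "subst \<sigma> (App w ts) = App w (map (subst \<sigma>) ts)"

text \<open>A variety of \<open>\<Omega>\<close>-groups is given by a set \<open>E\<close> of identities in countably many variables; it
  consists of the \<open>\<Omega>\<close>-groups, over any carrier type, that satisfy \<open>E\<close>.  The variety of all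
  \<open>\<Omega>\<close>-groups is given by \<open>E = {}\<close>.\<close>

type_synonym 'w identity = "(nat, 'w) expr \<times> (nat, 'w) expr"

definition identities :: "'w signature \<Rightarrow> 'w identity set" where
  "identities S = exprs S UNIV \<times> exprs S UNIV"

definition in_variety :: "'w signature \<Rightarrow> 'w identity set \<Rightarrow> ('a, 'w, 'm) ogroup_scheme \<Rightarrow> bool" where
  "in_variety S E G \<longleftrightarrow> omega_group S G \<and>
     (\<forall>(p, q) \<in> E. \<forall>v \<in> UNIV \<rightarrow> carrier G. eval G v p = eval G v q)"

text \<open>The least congruence on the expressions over \<open>X\<close> whose quotient is an \<open>\<Omega>\<close>-group satisfying
  \<open>E\<close>.\<close>

inductive_set free_rel ::
  "'w signature \<Rightarrow> 'w identity set \<Rightarrow> 'x set \<Rightarrow> (('x, 'w) expr \<times> ('x, 'w) expr) set"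
  for S :: "'w signature" and E :: "'w identity set" and X :: "'x set" where
  refl: "s \<in> exprs S X \<Longrightarrow> (s, s) \<in> free_rel S E X"
| sym: "(s, t) \<in> free_rel S E X \<Longrightarrow> (t, s) \<in> free_rel S E X"
| trans: "(s, t) \<in> free_rel S E X \<Longrightarrow> (t, u) \<in> free_rel S E X \<Longrightarrow> (s, u) \<in> free_rel S E X"
| Neg: "(s, t) \<in> free_rel S E X \<Longrightarrow> (Neg s, Neg t) \<in> free_rel S E X"
| Add: "(s, s') \<in> free_rel S E X \<Longrightarrow> (t, t') \<in> free_rel S E X \<Longrightarrow>
    (Add s t, Add s' t') \<in> free_rel S E X"
| App: "w \<in> ops S \<Longrightarrow> length ss = arity S w \<Longrightarrow> list_all2 (\<lambda>s t. (s, t) \<in> free_rel S E X) ss ts \<Longrightarrow>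
    (App w ss, App w ts) \<in> free_rel S E X"
| assoc: "s \<in> exprs S X \<Longrightarrow> t \<in> exprs S X \<Longrightarrow> u \<in> exprs S X \<Longrightarrow>
    (Add (Add s t) u, Add s (Add t u)) \<in> free_rel S E X"
| left_zero: "s \<in> exprs S X \<Longrightarrow> (Add Zero s, s) \<in> free_rel S E X"
| left_neg: "s \<in> exprs S X \<Longrightarrow> (Add (Neg s) s, Zero) \<in> free_rel S E X"
| App_zero: "w \<in> ops S \<Longrightarrow> (App w (replicate (arity S w) Zero), Zero) \<in> free_rel S E X"
| identity: "(p, q) \<in> E \<Longrightarrow> \<forall>i. \<sigma> i \<in> exprs S X \<Longrightarrow> (subst \<sigma> p, subst \<sigma> q) \<in> free_rel S E X"

definition free_omega_group ::
  "'w signature \<Rightarrow> 'w identity set \<Rightarrow> 'x set \<Rightarrow> (('x, 'w) expr set, 'w) ogroup" where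
  "free_omega_group S E X =
    \<lparr>carrier = exprs S X // free_rel S E X,
     mult = (\<lambda>A B. free_rel S E X `` {Add s t |s t. s \<in> A \<and> t \<in> B}),
     one = free_rel S E X `` {Zero},
     opn = (\<lambda>w As. free_rel S E X `` {App w ts |ts. list_all2 (\<in>) ts As})\<rparr>"

definition generator ::
  "'w signature \<Rightarrow> 'w identity set \<Rightarrow> 'x set \<Rightarrow> 'x \<Rightarrow> ('x, 'w) expr set" where
  "generator S E X x = free_rel S E X `` {Var x}"

text \<open>The value of an element of a free \<open>\<Omega>\<close>-group, i.e. of a class \<open>f\<close> of expressions, under an
  assignment \<open>v\<close>; all members of the class have the same value (lemma \<open>word_value_cls\<close>).\<close>

definition word_value :: "('a, 'w, 'm) ogroup_scheme \<Rightarrow> ('x \<Rightarrow> 'a) \<Rightarrow> ('x, 'w) expr set \<Rightarrow> 'a" where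
  "word_value G v f = the_elem (eval G v ` f)"


section \<open>Commutators and anticommutativity\<close>

text \<open>The tuples of variables are \<open>Inl 0, \<dots>, Inl (m - 1)\<close> and \<open>Inr 0, \<dots>, Inr (n - 1)\<close>.\<close>

abbreviation two_tuples :: "nat \<Rightarrow> nat \<Rightarrow> (nat + nat) set" where
  "two_tuples m n \<equiv> {..<m} <+> {..<n}"

definition commutator_word :: "'w signature \<Rightarrow> nat \<Rightarrow> nat \<Rightarrow> (nat + nat, 'w) expr set \<Rightarrow> bool" where
  "commutator_word S m n f \<longleftrightarrow>
    (let F = free_omega_group S {} (two_tuples m n); g = generator S {} (two_tuples m n) in
      f \<in> carrier F \<and>
      word_value F (case_sum (\<lambda>i. g (Inl i)) (\<lambda>j. \<one>\<^bsub>F\<^esub>)) f = \<one>\<^bsub>F\<^esub> \<and>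
      word_value F (case_sum (\<lambda>i. \<one>\<^bsub>F\<^esub>) (\<lambda>j. g (Inr j))) f = \<one>\<^bsub>F\<^esub>)"

definition omega_commutator ::
  "'w signature \<Rightarrow> ('a, 'w, 'm) ogroup_scheme \<Rightarrow> 'a set \<Rightarrow> 'a set \<Rightarrow> 'a set" where
  "omega_commutator S G A B =
    {word_value G (case_sum a b) f |m n f a b.
       commutator_word S m n f \<and> a \<in> {..<m} \<rightarrow> A \<and> b \<in> {..<n} \<rightarrow> B}"

definition abelian :: "'w signature \<Rightarrow> ('a, 'w, 'm) ogroup_scheme \<Rightarrow> bool" where
  "abelian S G \<longleftrightarrow> omega_commutator S G (carrier G) (carrier G) = {\<one>\<^bsub>G\<^esub>}"

definition anticommutative :: "'w signature \<Rightarrow> ('a, 'w, 'm) ogroup_scheme \<Rightarrow> bool" where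
  "anticommutative S L \<longleftrightarrow>
     \<not> (\<exists>U. omega_ideal S U L \<and> U \<noteq> {\<one>\<^bsub>L\<^esub>} \<and> abelian S (L\<lparr>carrier := U\<rparr>)) \<and>
     (\<forall>U V. omega_ideal S U L \<and> U \<noteq> {\<one>\<^bsub>L\<^esub>} \<and> omega_ideal S V L \<and> V \<noteq> {\<one>\<^bsub>L\<^esub>} \<longrightarrow>
        U \<inter> V \<noteq> {\<one>\<^bsub>L\<^esub>})"

definition C_anticommutative :: "'w signature \<Rightarrow> ('a, 'w, 'm) ogroup_scheme \<Rightarrow> bool" where
  "C_anticommutative S H \<longleftrightarrow>
     (\<forall>L. omega_subgroup S L H \<and> L \<noteq> {\<one>\<^bsub>H\<^esub>} \<longrightarrow> anticommutative S (H\<lparr>carrier := L\<rparr>))"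


section \<open>Equational domains\<close>

definition algebraic_variety ::
  "'w signature \<Rightarrow> 'w identity set \<Rightarrow> 'x set \<Rightarrow> ('a, 'w, 'm) ogroup_scheme \<Rightarrow>
    (('x, 'w) expr set \<Rightarrow> 'a) set \<Rightarrow> bool" where
  "algebraic_variety S E X H A \<longleftrightarrow>
     (\<exists>T \<subseteq> carrier (free_omega_group S E X).
        A = {\<mu> \<in> omega_hom S (free_omega_group S E X) H. T \<subseteq> kernel (free_omega_group S E X) H \<mu>})"

text \<open>Finite sets of natural numbers represent all finite sets \<open>X\<close> of variables.\<close>

definition equational_domain ::
  "'w signature \<Rightarrow> 'w identity set \<Rightarrow> ('a, 'w, 'm) ogroup_scheme \<Rightarrow> bool" where
  "equational_domain S E H \<longleftrightarrow>
     (\<forall>X :: nat set. finite X \<longrightarrow>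
       (\<forall>A B. algebraic_variety S E X H A \<and> algebraic_variety S E X H B \<longrightarrow>
          algebraic_variety S E X H (A \<union> B)))"


section \<open>Correctness of the construction of free Omega-groups\<close>

lemma eval_closed:
  assumes "omega_group S G" "v \<in> X \<rightarrow> carrier G" "s \<in> exprs S X"
  shows "eval G v s \<in> carrier G"
proof -
  interpret omega_group S G by fact
  show ?thesis using assms(3)
  proof induction
    case (App w ts)
    then show ?case by (auto intro!: opn_closed simp: tuples_def)
  qed (use assms(2) in auto)
qed

lemma subst_closed:
  assumes "s \<in> exprs S X" "\<And>x. x \<in> X \<Longrightarrow> \<sigma> x \<in> exprs S Y"
  shows "subst \<sigma> s \<in> exprs S Y"
  using assms(1)
proof induction
  case (App w ts)
  then show ?case by (auto intro!: exprs.App)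
qed (auto intro: exprs.intros assms(2))

lemma eval_subst:
  "eval G v (subst \<sigma> s) = eval G (\<lambda>x. eval G v (\<sigma> x)) s"
  by (induction s) (auto simp: comp_def cong: map_cong)

lemma free_rel_exprs:
  assumes "E \<subseteq> identities S" "(s, t) \<in> free_rel S E X"
  shows "s \<in> exprs S X \<and> t \<in> exprs S X"
  using assms(2)
proof induction
  case (App w ss ts)
  then show ?case
    by (auto intro!: exprs.App simp: list_all2_conv_all_nth in_set_conv_nth)
next
  case (identity p q \<sigma>)
  then show ?case using assms(1) by (auto simp: identities_def intro!: subst_closed)
next
  case (App_zero w)
  then show ?case by (auto intro!: exprs.App exprs.Zero)
qed (auto intro: exprs.intros)

lemma equiv_free_rel:
  assumes "E \<subseteq> identities S"
  shows "equiv (exprs S X) (free_rel S E X)"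
proof (rule equivI)
  show "free_rel S E X \<subseteq> exprs S X \<times> exprs S X"
    using free_rel_exprs[OF assms] by auto
  show "refl_on (exprs S X) (free_rel S E X)"
    using free_rel.refl by (auto simp: refl_on_def)
  show "sym (free_rel S E X)" by (auto intro: symI free_rel.sym)
  show "trans (free_rel S E X)" by (auto intro: transI free_rel.trans)
qed

lemma free_rel_sound:
  assumes "E \<subseteq> identities S" "in_variety S E G" "v \<in> X \<rightarrow> carrier G" "(s, t) \<in> free_rel S E X"
  shows "eval G v s = eval G v t"
proof -
  interpret omega_group S G using assms(2) by (simp add: in_variety_def)
  have cl: "s \<in> exprs S X \<Longrightarrow> eval G v s \<in> carrier G" for s
    using eval_closed[OF omega_group_axioms assms(3)] by blast
  show ?thesis using assms(4)
  proof induction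
    case (App w ss ts)
    then have "map (eval G v) ss = map (eval G v) ts"
      by (auto simp: list_all2_conv_all_nth intro!: nth_equalityI)
    then show ?case by simp
  next
    case (identity p q \<sigma>)
    then show ?case using assms(2) cl
      by (fastforce simp: eval_subst in_variety_def)
  qed (auto simp: m_assoc cl opn_one)
qed

context
  fixes S :: "'w signature" and E :: "'w identity set" and X :: "'x set"
  assumes arity: "\<And>w. w \<in> ops S \<Longrightarrow> 0 < arity S w" and E: "E \<subseteq> identities S"
begin

abbreviation (input) "free_cls s \<equiv> free_rel S E X `` {s}"

lemma free_carrier:
  "f \<in> carrier (free_omega_group S E X) \<longleftrightarrow> (\<exists>s \<in> exprs S X. f = free_cls s)"
  by (auto simp: free_omega_group_def quotient_def)

lemma free_cls_eq: "(s, t) \<in> free_rel S E X \<Longrightarrow> free_cls s = free_cls t"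
  using equiv_class_eq[OF equiv_free_rel[OF E]] by blast

lemma free_rel_Image:
  assumes "s \<in> P" "\<And>t. t \<in> P \<Longrightarrow> (s, t) \<in> free_rel S E X"
  shows "free_rel S E X `` P = free_cls s"
  using assms by (auto intro: free_rel.trans)

lemma free_mult:
  assumes "s \<in> exprs S X" "t \<in> exprs S X"
  shows "free_cls s \<otimes>\<^bsub>free_omega_group S E X\<^esub> free_cls t = free_cls (Add s t)"
  unfolding free_omega_group_def monoid.simps
  by (rule free_rel_Image) (use assms in \<open>auto intro: free_rel.refl free_rel.Add\<close>)

lemma free_one: "\<one>\<^bsub>free_omega_group S E X\<^esub> = free_cls Zero"
  by (simp add: free_omega_group_def)

lemma free_opn:
  assumes "w \<in> ops S" "ts \<in> tuples (arity S w) (exprs S X)"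
  shows "opn (free_omega_group S E X) w (map (\<lambda>s. free_cls s) ts) = free_cls (App w ts)"
proof -
  have "list_all2 (\<in>) ts (map (\<lambda>s. free_cls s) ts)"
    using assms(2) by (auto simp: tuples_def list_all2_conv_all_nth intro!: free_rel.refl)
  moreover have "(App w ts, App w us) \<in> free_rel S E X"
    if "list_all2 (\<in>) us (map (\<lambda>s. free_cls s) ts)" for us
    using that assms by (intro free_rel.App) (auto simp: tuples_def list_all2_conv_all_nth)
  ultimately show ?thesis
    unfolding free_omega_group_def ogroup.simps by (intro free_rel_Image) auto
qed

lemma tuples_free:
  assumes "as \<in> tuples n (carrier (free_omega_group S E X))"
  obtains ts where "ts \<in> tuples n (exprs S X)" "as = map (\<lambda>s. free_cls s) ts"
proof -
  obtain r where r: "\<And>f. f \<in> carrier (free_omega_group S E X) \<Longrightarrow> r f \<in> exprs S X \<and> free_cls (r f) = f"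
    using free_carrier by metis
  have "map r as \<in> tuples n (exprs S X)" using assms r by (auto simp: tuples_def)
  moreover have "as = map (\<lambda>s. free_cls s) (map r as)"
    unfolding map_map by (rule map_idI[symmetric]) (use assms r in \<open>auto simp: tuples_def\<close>)
  ultimately show ?thesis by (rule that)
qed

lemma omega_group_free: "omega_group S (free_omega_group S E X)"
proof -
  let ?F = "free_omega_group S E X"
  have cl: "free_cls s \<in> carrier ?F" if "s \<in> exprs S X" for s
    using that free_carrier by blast
  have "group ?F"
  proof (rule groupI)
    fix f g assume "f \<in> carrier ?F" "g \<in> carrier ?F"
    then show "f \<otimes>\<^bsub>?F\<^esub> g \<in> carrier ?F"
      by (metis free_carrier free_mult exprs.Add)
  next
    show "\<one>\<^bsub>?F\<^esub> \<in> carrier ?F" using cl[OF exprs.Zero] by (simp add: free_one)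
  next
    fix f g h assume "f \<in> carrier ?F" "g \<in> carrier ?F" "h \<in> carrier ?F"
    then obtain s t u where stu: "s \<in> exprs S X" "t \<in> exprs S X" "u \<in> exprs S X"
      and fgh: "f = free_cls s" "g = free_cls t" "h = free_cls u" by (auto simp only: free_carrier)
    show "f \<otimes>\<^bsub>?F\<^esub> g \<otimes>\<^bsub>?F\<^esub> h = f \<otimes>\<^bsub>?F\<^esub> (g \<otimes>\<^bsub>?F\<^esub> h)"
      using free_cls_eq[OF free_rel.assoc[OF stu]] unfolding fgh
      by (simp only: free_mult stu exprs.Add)
  next
    fix f assume "f \<in> carrier ?F"
    then obtain s where s: "s \<in> exprs S X" and f: "f = free_cls s" by (auto simp only: free_carrier)
    show "\<one>\<^bsub>?F\<^esub> \<otimes>\<^bsub>?F\<^esub> f = f"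
      using free_cls_eq[OF free_rel.left_zero[OF s]] unfolding f free_one
      by (simp only: free_mult s exprs.Zero)
    have "free_cls (Neg s) \<otimes>\<^bsub>?F\<^esub> f = \<one>\<^bsub>?F\<^esub>"
      using free_cls_eq[OF free_rel.left_neg[OF s]] unfolding f free_one
      by (simp only: free_mult s exprs.Neg)
    then show "\<exists>g \<in> carrier ?F. g \<otimes>\<^bsub>?F\<^esub> f = \<one>\<^bsub>?F\<^esub>" using cl[OF exprs.Neg[OF s]] by blast
  qed
  then show ?thesis
  proof (intro omega_group.intro omega_group_axioms.intro)
    fix w as assume w: "w \<in> ops S" and "as \<in> tuples (arity S w) (carrier ?F)"
    then obtain ts where "ts \<in> tuples (arity S w) (exprs S X)" "as = map (\<lambda>s. free_cls s) ts"
      using tuples_free by blast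
    moreover from this have "App w ts \<in> exprs S X"
      using w by (auto simp: tuples_def intro!: exprs.App)
    ultimately show "opn ?F w as \<in> carrier ?F" using w cl by (simp add: free_opn)
  next
    fix w assume w: "w \<in> ops S"
    have "replicate (arity S w) (Zero :: ('x, 'w) expr) \<in> tuples (arity S w) (exprs S X)"
      by (auto simp: tuples_def intro: exprs.Zero)
    from free_opn[OF w this] show "opn ?F w (replicate (arity S w) \<one>\<^bsub>?F\<^esub>) = \<one>\<^bsub>?F\<^esub>"
      using free_cls_eq[OF free_rel.App_zero[OF w]] by (simp add: free_one map_replicate_const)
  qed (use arity in auto)
qed

lemma free_inv:
  assumes s: "s \<in> exprs S X"
  shows "inv\<^bsub>free_omega_group S E X\<^esub> (free_cls s) = free_cls (Neg s)"
proof -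
  interpret F: omega_group S "free_omega_group S E X" by (rule omega_group_free)
  have "free_cls (Neg s) \<otimes>\<^bsub>free_omega_group S E X\<^esub> free_cls s = \<one>\<^bsub>free_omega_group S E X\<^esub>"
    using free_cls_eq[OF free_rel.left_neg[OF s]] unfolding free_one
    by (simp only: free_mult s exprs.Neg)
  then show ?thesis using s exprs.Neg[OF s] free_carrier by (intro F.inv_equality) blast+
qed

lemma eval_free:
  assumes "p \<in> exprs S Y" "\<And>y. y \<in> Y \<Longrightarrow> \<sigma> y \<in> exprs S X"
  shows "eval (free_omega_group S E X) (\<lambda>y. free_cls (\<sigma> y)) p = free_cls (subst \<sigma> p)"
  using assms(1)
proof induction
  case (Neg s)
  have s: "subst \<sigma> s \<in> exprs S X" using Neg assms(2) by (blast intro: subst_closed)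
  have "eval (free_omega_group S E X) (\<lambda>y. free_cls (\<sigma> y)) (Neg s)
      = inv\<^bsub>free_omega_group S E X\<^esub> (free_cls (subst \<sigma> s))" using Neg by simp
  also have "\<dots> = free_cls (Neg (subst \<sigma> s))" by (rule free_inv[OF s])
  finally show ?case by simp
next
  case (App w ts)
  then have "map (eval (free_omega_group S E X) (\<lambda>y. free_cls (\<sigma> y))) ts
      = map (\<lambda>s. free_cls s) (map (subst \<sigma>) ts)"
    by (auto intro!: nth_equalityI)
  moreover have "map (subst \<sigma>) ts \<in> tuples (arity S w) (exprs S X)"
    using App assms(2) by (auto simp: tuples_def intro: subst_closed)
  ultimately show ?case by (simp only: eval.simps subst.simps free_opn[OF App(1)])
qed (use assms(2) in \<open>auto simp: free_one free_mult subst_closed\<close>)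

lemma in_variety_free: "in_variety S E (free_omega_group S E X)"
  unfolding in_variety_def
proof (intro conjI omega_group_free, clarify)
  fix p q v assume pq: "(p, q) \<in> E" and v: "v \<in> (UNIV :: nat set) \<rightarrow> carrier (free_omega_group S E X)"
  have "\<forall>i. \<exists>s. s \<in> exprs S X \<and> v i = free_cls s" using v by (auto simp: free_carrier Pi_def)
  then obtain \<sigma> where \<sigma>: "\<And>i. \<sigma> i \<in> exprs S X" "v = (\<lambda>i. free_cls (\<sigma> i))"
    by (metis (no_types, lifting) ext)
  have "free_cls (subst \<sigma> p) = free_cls (subst \<sigma> q)"
    using pq \<sigma>(1) by (intro free_cls_eq free_rel.identity) auto
  moreover have "p \<in> exprs S UNIV" "q \<in> exprs S UNIV" using pq E by (auto simp: identities_def)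
  ultimately show "eval (free_omega_group S E X) v p = eval (free_omega_group S E X) v q"
    using \<sigma> by (simp add: eval_free)
qed

lemma generator_free: "x \<in> X \<Longrightarrow> generator S E X x \<in> carrier (free_omega_group S E X)"
  by (auto simp: generator_def free_carrier intro: exprs.Var)

lemma word_value_cls:
  assumes "in_variety S E G" "v \<in> X \<rightarrow> carrier G" "s \<in> exprs S X"
  shows "word_value G v (free_cls s) = eval G v s"
proof -
  have "eval G v ` free_cls s = {eval G v s}"
    using free_rel_sound[OF E assms(1,2)] free_rel.refl[OF assms(3)] by auto
  then show ?thesis by (simp add: word_value_def)
qed

theorem free_universal:
  assumes G: "in_variety S E G" and v: "v \<in> X \<rightarrow> carrier G"
  shows "\<exists>!\<mu>. \<mu> \<in> omega_hom S (free_omega_group S E X) G \<and> (\<forall>x \<in> X. \<mu> (generator S E X x) = v x)"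
    and "restrict (word_value G v) (carrier (free_omega_group S E X))
           \<in> omega_hom S (free_omega_group S E X) G"
proof -
  let ?F = "free_omega_group S E X"
  let ?\<mu> = "restrict (word_value G v) (carrier ?F)"
  interpret omega_group S G using G by (simp add: in_variety_def)
  interpret F: omega_group S ?F by (rule omega_group_free)
  have val: "?\<mu> (free_cls s) = eval G v s" if "s \<in> exprs S X" for s
    using word_value_cls[OF G v that] that by (auto simp: free_carrier)
  have cl: "eval G v s \<in> carrier G" if "s \<in> exprs S X" for s
    using eval_closed[OF omega_group_axioms v that] .
  have hom: "?\<mu> \<in> hom ?F G"
  proof (rule homI)
    fix f g assume "f \<in> carrier ?F" "g \<in> carrier ?F"
    then obtain s t where st: "s \<in> exprs S X" "t \<in> exprs S X" "f = free_cls s" "g = free_cls t"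
      by (auto simp: free_carrier)
    then show "?\<mu> f \<in> carrier G" using val cl by metis
    show "?\<mu> (f \<otimes>\<^bsub>?F\<^esub> g) = ?\<mu> f \<otimes>\<^bsub>G\<^esub> ?\<mu> g"
      using st val exprs.Add[OF st(1,2)] by (metis eval.simps(4) free_mult)
  qed
  have ohom: "?\<mu> (opn ?F w as) = opn G w (map ?\<mu> as)"
    if w: "w \<in> ops S" and as: "as \<in> tuples (arity S w) (carrier ?F)" for w as
  proof -
    obtain ts where ts: "ts \<in> tuples (arity S w) (exprs S X)" "as = map (\<lambda>s. free_cls s) ts"
      using as tuples_free by blast
    then have "App w ts \<in> exprs S X" using w by (auto simp: tuples_def intro!: exprs.App)
    moreover have "map ?\<mu> as = map (eval G v) ts"
      using ts val by (auto simp: tuples_def subset_iff simp del: restrict_apply)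
    ultimately show ?thesis using val w ts by (metis eval.simps(5) free_opn)
  qed
  show \<mu>: "?\<mu> \<in> omega_hom S ?F G"
  proof -
    have "?\<mu> \<in> carrier ?F \<rightarrow>\<^sub>E carrier G"
      using hom unfolding hom_def PiE_def by (simp only: restrict_extensional mem_Collect_eq Int_iff simp_thms)
    then show ?thesis unfolding omega_hom_def using hom ohom by blast
  qed
  show "\<exists>!\<mu>. \<mu> \<in> omega_hom S ?F G \<and> (\<forall>x \<in> X. \<mu> (generator S E X x) = v x)"
  proof (intro ex1I conjI ballI, rule \<mu>)
    fix x assume "x \<in> X"
    then show "?\<mu> (generator S E X x) = v x"
      unfolding generator_def using val[OF exprs.Var] by simp
  next
    fix \<nu> assume \<nu>: "\<nu> \<in> omega_hom S ?F G \<and> (\<forall>x \<in> X. \<nu> (generator S E X x) = v x)"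
    then have h: "\<nu> \<in> hom ?F G" and e: "\<nu> \<in> carrier ?F \<rightarrow>\<^sub>E carrier G" by (auto simp: omega_hom_def)
    then interpret \<nu>: group_hom ?F G \<nu>
      by unfold_locales
    have "\<nu> (free_cls s) = eval G v s" if "s \<in> exprs S X" for s using that
    proof induction
      case (Var x)
      then show ?case using \<nu> by (simp add: generator_def)
    next
      case Zero
      then show ?case using \<nu>.hom_one by (simp add: free_one)
    next
      case (Neg s)
      then show ?case by (metis \<nu>.hom_inv eval.simps(3) free_carrier free_inv)
    next
      case (Add s t)
      then show ?case by (metis \<nu>.hom_mult eval.simps(4) free_carrier free_mult)
    next
      case (App w ts)
      then have ts: "ts \<in> tuples (arity S w) (exprs S X)" by (auto simp: tuples_def)
      then have "map (\<lambda>s. free_cls s) ts \<in> tuples (arity S w) (carrier ?F)"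
        unfolding tuples_def using free_carrier by fastforce
      moreover have "map \<nu> (map (\<lambda>s. free_cls s) ts) = map (eval G v) ts"
        using App by (auto simp: tuples_def)
      moreover have "\<nu> (opn ?F w as) = opn G w (map \<nu> as)"
        if "as \<in> tuples (arity S w) (carrier ?F)" for as
        using \<nu> App(1) that unfolding omega_hom_def by blast
      ultimately show ?case by (simp only: eval.simps free_opn[OF App(1) ts, symmetric])
    qed
    then have "\<nu> f = ?\<mu> f" if "f \<in> carrier ?F" for f
      using that val by (metis free_carrier)
    then show "\<nu> = ?\<mu>" using e
      by (intro extensionalityI[of _ "carrier ?F"]) (auto simp: PiE_def)
  qed
qed

end

end

theory Submission
  imports Defs
begin

text \<open>Both properties in the theorem are equivalent to a third one, the absence of zero divisors:
  if \<open>a\<close> and \<open>b\<close> satisfy \<open>[{a}, {b}] = 0\<close>, then \<open>a = 0\<close> or \<open>b = 0\<close>.  Here the commutator plays the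
  part that the product plays for rings.

  \<^emph>\<open>Equational domains.\<close>  Commutators commute with homomorphisms (\<open>omega_commutator_image\<close>).  Hence,
  if there are no zero divisors, a homomorphism kills \<open>[T1, T2]\<close> exactly if it kills \<open>T1\<close> or \<open>T2\<close>, so
  the union of the varieties of \<open>T1\<close> and \<open>T2\<close> is the variety of \<open>[T1, T2]\<close> (\<open>algebraic_set_Un\<close>), just
  as for products of ideals.  Conversely, suppose that the union of the two coordinate axes
  \<open>x = 0\<close> and \<open>y = 0\<close> is defined by a set \<open>T\<close> of words in \<open>x\<close> and \<open>y\<close>.  Every \<open>f\<close> in \<open>T\<close> vanishes on
  the axes of \<open>H\<close>, and so it has the same values on \<open>H\<close> as the word
  \<open>- f(x, 0) + f(x, y) - f(0, y)\<close>, which is a commutator word in all \<open>\<Omega>\<close>-groups.  If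
  \<open>[{a}, {b}] = 0\<close>, then the point \<open>(a, b)\<close> is therefore a zero of \<open>T\<close>, i.e. it lies on an axis.

  \<^emph>\<open>Anticommutativity.\<close>  The commutator of two ideals lies in their intersection
  (\<open>omega_commutator_ideals\<close>), because modulo an ideal the arguments from this ideal may be replaced
  by \<open>0\<close>.  So two non-trivial ideals with trivial intersection contain zero divisors, and
  any nonzero element of an abelian ideal is a zero divisor with itself.  Conversely, let
  \<open>[{a}, {b}] = 0\<close> with \<open>a\<close> and \<open>b\<close> nonzero, let \<open>F\<close> be the free \<open>\<Omega>\<close>-group on \<open>x\<close> and \<open>y\<close>, and let
  \<open>\<mu>\<close> map \<open>F\<close> onto the \<open>\<Omega>\<close>-subgroup \<open>L\<close> generated by \<open>a\<close> and \<open>b\<close>.  The words that vanish for \<open>x = 0\<close>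
  form an ideal \<open>K1\<close> of \<open>F\<close>, those that vanish for \<open>y = 0\<close> an ideal \<open>K2\<close>, and \<open>K1 \<inter> K2\<close> consists of the
  commutator words, which \<open>\<mu>\<close> kills.  Hence the ideals \<open>\<mu> ` K1\<close> and \<open>\<mu> ` K2\<close> of \<open>L\<close>, which contain \<open>a\<close>
  and \<open>b\<close>, satisfy \<open>[\<mu> ` K1, \<mu> ` K2] = \<mu> ` [K1, K2] \<subseteq> \<mu> ` (K1 \<inter> K2) = 0\<close>.  Their intersection is
  either trivial or a non-trivial abelian ideal of \<open>L\<close>, and \<open>L\<close> is not anticommutative.\<close>

section \<open>Evaluation of expressions under homomorphisms and in subgroups\<close>

lemma eval_cong:
  assumes "s \<in> exprs S X" "\<And>x. x \<in> X \<Longrightarrow> v x = v' x"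
  shows "eval G v s = eval G v' s"
  using assms(1)
proof induction
  case (App w ts)
  then have "map (eval G v) ts = map (eval G v') ts" by simp
  then show ?case by (simp only: eval.simps)
qed (use assms(2) in auto)

lemma omega_homD:
  assumes "\<mu> \<in> omega_hom S G H"
  shows "\<mu> \<in> hom G H"
    and "w \<in> ops S \<Longrightarrow> as \<in> tuples (arity S w) (carrier G) \<Longrightarrow> \<mu> (opn G w as) = opn H w (map \<mu> as)"
  using assms by (auto simp: omega_hom_def)

lemma omega_hom_group_hom:
  assumes "omega_group S G" "omega_group S H" "\<mu> \<in> omega_hom S G H"
  shows "group_hom G H \<mu>"
  using assms by (simp add: group_hom_def group_hom_axioms_def omega_group_def omega_homD)

lemma omega_group_in_variety: "omega_group S G \<Longrightarrow> in_variety S {} G"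
  by (simp add: in_variety_def)

lemma omega_hom_eval:
  assumes "omega_group S G" "omega_group S H" "\<mu> \<in> omega_hom S G H"
    and "v \<in> X \<rightarrow> carrier G" "s \<in> exprs S X"
  shows "\<mu> (eval G v s) = eval H (\<lambda>x. \<mu> (v x)) s"
proof -
  interpret group_hom G H \<mu> by (rule omega_hom_group_hom) fact+
  have cl: "eval G v t \<in> carrier G" if "t \<in> exprs S X" for t
    using eval_closed[OF assms(1,4) that] .
  show ?thesis using assms(5)
  proof induction
    case (App w ts)
    then have "map (eval G v) ts \<in> tuples (arity S w) (carrier G)"
      using cl by (auto simp: tuples_def)
    with App show ?case
      by (simp add: omega_homD(2)[OF assms(3)] comp_def cong: map_cong)
  qed (auto simp: cl)
qed

lemma tuples_mono: "as \<in> tuples n A \<Longrightarrow> A \<subseteq> B \<Longrightarrow> as \<in> tuples n B"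
  by (auto simp: tuples_def)

lemma tuples_image:
  assumes "bs \<in> tuples n (f ` A)"
  obtains as where "as \<in> tuples n A" "bs = map f as"
proof -
  have "bs \<in> lists (f ` A)" using assms by (auto simp: tuples_def)
  then obtain as where "as \<in> lists A" "bs = map f as" unfolding lists_image by blast
  then show ?thesis using assms by (intro that) (auto simp: tuples_def)
qed

section \<open>Omega-subgroups and ideals\<close>

context omega_group
begin

lemma omega_subgroup_omega_group:
  assumes "omega_subgroup S L G"
  shows "omega_group S (G\<lparr>carrier := L\<rparr>)"
proof -
  have "subgroup L G" using assms by (simp add: omega_subgroup_def)
  then have "group (G\<lparr>carrier := L\<rparr>)" by (rule subgroup_imp_group)
  then show ?thesis
    using assms arity_pos opn_one
    by (simp add: omega_group_def omega_group_axioms_def omega_subgroup_def omega_closed_def)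
qed

text \<open>The inverse is the only operation that refers to the carrier, being defined by a description
  over it; on a subgroup it agrees with the inverse of \<open>G\<close>.\<close>

lemma eval_omega_subgroup:
  assumes L: "omega_subgroup S L G" and v: "v \<in> X \<rightarrow> L" and s: "s \<in> exprs S X"
  shows "eval (G\<lparr>carrier := L\<rparr>) v s = eval G v s"
  using s
proof induction
  case (Neg s)
  have "eval (G\<lparr>carrier := L\<rparr>) v s \<in> L"
    using eval_closed[OF omega_subgroup_omega_group[OF L] _ Neg(1)] v by auto
  then show ?case using Neg L m_inv_consistent by (simp add: omega_subgroup_def)
qed (auto simp: cong: map_cong)

lemma omega_ideal_omega_subgroup:
  "omega_ideal S U G \<Longrightarrow> omega_subgroup S U G"
  by (simp add: omega_ideal_def omega_subgroup_def normal_imp_subgroup)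

lemma omega_ideal_trivial: "omega_ideal S {\<one>} G"
proof -
  have t: "as = replicate n \<one>" if "as \<in> tuples n {\<one>}" for as n
    using that by (auto simp: tuples_def intro: replicate_eqI)
  have "bracket G (replicate (arity S w) \<one>) bs w = \<one>"
    if "w \<in> ops S" "bs \<in> tuples (arity S w) (carrier G)" for w bs
  proof -
    have "map2 (\<otimes>) (replicate (arity S w) \<one>) bs = bs"
      using that by (intro nth_equalityI) (auto simp: tuples_def subset_iff)
    then show ?thesis
      using that by (simp add: bracket_def opn_one opn_closed)
  qed
  then show ?thesis
    by (auto simp: omega_ideal_def omega_closed_def opn_one one_is_normal dest!: t)
qed

lemma omega_ideal_carrier: "omega_ideal S (carrier G) G"
  unfolding omega_ideal_def
proof (intro conjI ballI)
  show "omega_closed S (carrier G) G" by (simp add: omega_closed_def opn_closed)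
  show "carrier G \<lhd> G" by (simp add: normal_inv_iff subgroup_self)
  fix w as bs assume "w \<in> ops S" "as \<in> tuples (arity S w) (carrier G)"
    "bs \<in> tuples (arity S w) (carrier G)"
  moreover from this have "map2 (\<otimes>) as bs \<in> tuples (arity S w) (carrier G)"
    by (force simp: tuples_def in_set_conv_nth)
  ultimately show "bracket G as bs w \<in> carrier G"
    by (simp add: bracket_def opn_closed)
qed

lemma omega_ideal_Int:
  assumes "omega_ideal S U G" "omega_ideal S V G"
  shows "omega_ideal S (U \<inter> V) G"
  using assms unfolding omega_ideal_def omega_closed_def
  by (auto simp: normal_inv_iff subgroups_Inter_pair dest: tuples_mono[OF _ Int_lower1] tuples_mono[OF _ Int_lower2])

text \<open>Ideals are the kernels of congruences: arguments that are congruent modulo \<open>U\<close> give congruent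
  values.  For an operation this is what the third condition on ideals is made for: with
  \<open>a = u + b\<close> and \<open>u\<close> in \<open>U\<close>, the bracket \<open>[u; b; \<omega>]\<close> compares the values at \<open>a\<close> and at \<open>b\<close>.\<close>

lemma omega_ideal_eval_coset:
  assumes U: "omega_ideal S U G"
    and v: "v \<in> X \<rightarrow> carrier G" and v': "v' \<in> X \<rightarrow> carrier G"
    and eq: "\<And>x. x \<in> X \<Longrightarrow> U #> v x = U #> v' x" and s: "s \<in> exprs S X"
  shows "U #> eval G v s = U #> eval G v' s"
proof -
  interpret U: normal U G using U by (simp add: omega_ideal_def)
  have cl: "eval G v t \<in> carrier G" "eval G v' t \<in> carrier G" if "t \<in> exprs S X" for t
    using eval_closed[OF omega_group_axioms _ that] v v' by auto
  show ?thesis using s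
  proof induction
    case (Neg s)
    then show ?case using cl by (metis U.rcos_inv eval.simps(3))
  next
    case (Add s t)
    then show ?case using cl by (metis U.rcos_sum eval.simps(4))
  next
    case (App w ts)
    let ?as = "map (eval G v) ts" and ?bs = "map (eval G v') ts"
    have "\<forall>t \<in> set ts. \<exists>u \<in> U. eval G v t = u \<otimes> eval G v' t"
    proof
      fix t assume "t \<in> set ts"
      then have "U #> eval G v t = U #> eval G v' t" "t \<in> exprs S X" using App by auto
      then have "eval G v t \<in> U #> eval G v' t"
        using rcos_self[of "eval G v t" U] cl U.subgroup_axioms by simp
      then show "\<exists>u \<in> U. eval G v t = u \<otimes> eval G v' t" by (auto simp: r_coset_def)
    qed
    then obtain u where u: "\<And>t. t \<in> set ts \<Longrightarrow> u t \<in> U \<and> eval G v t = u t \<otimes> eval G v' t"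
      by metis
    let ?us = "map u ts"
    have us: "?us \<in> tuples (arity S w) U" and bs: "?bs \<in> tuples (arity S w) (carrier G)"
      and as: "?as \<in> tuples (arity S w) (carrier G)"
      using App u cl by (auto simp: tuples_def)
    have "map2 (\<otimes>) ?us ?bs = ?as"
      using u by (intro nth_equalityI) auto
    then have "bracket G ?us ?bs w = inv (opn G w ?us) \<otimes> inv (opn G w ?bs) \<otimes> opn G w ?as"
      by (simp add: bracket_def)
    moreover have "bracket G ?us ?bs w \<in> U" and ou: "opn G w ?us \<in> U"
      using U us bs App(1) unfolding omega_ideal_def omega_closed_def by blast+
    moreover note cls = opn_closed[OF App(1) as] opn_closed[OF App(1) bs] U.mem_carrier[OF ou]
    ultimately have "inv (opn G w ?bs) \<otimes> opn G w ?as = opn G w ?us \<otimes> bracket G ?us ?bs w"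
      by (simp add: m_assoc[symmetric])
    then have "inv (opn G w ?bs) \<otimes> opn G w ?as \<in> U"
      using \<open>bracket G ?us ?bs w \<in> U\<close> ou by simp
    then have "opn G w ?bs \<otimes> (inv (opn G w ?bs) \<otimes> opn G w ?as) \<in> opn G w ?bs <# U"
      by (auto simp: l_coset_def)
    then have "opn G w ?as \<in> U #> opn G w ?bs"
      using cls U.coset_eq by (simp add: m_assoc[symmetric])
    then have "U #> opn G w ?bs = U #> opn G w ?as"
      using cls by (intro repr_independence U.subgroup_axioms)
    then show ?case by simp
  qed (use eq in auto)
qed

end

lemma omega_ideal_kernel:
  assumes G: "omega_group S G" and H: "omega_group S H" and \<mu>: "\<mu> \<in> omega_hom S G H"
  shows "omega_ideal S (kernel G H \<mu>) G"
proof -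
  interpret G: omega_group S G by fact
  interpret H: omega_group S H by fact
  interpret group_hom G H \<mu> by (rule omega_hom_group_hom) fact+
  have one: "\<mu> (opn G w as) = \<one>\<^bsub>H\<^esub>" "opn G w as \<in> carrier G"
    if "w \<in> ops S" "as \<in> tuples (arity S w) (kernel G H \<mu>)" for w as
  proof -
    have as: "as \<in> tuples (arity S w) (carrier G)"
      using that(2) by (rule tuples_mono) (auto simp: kernel_def)
    then show "opn G w as \<in> carrier G" using that(1) by (rule G.opn_closed[rotated])
    have "map \<mu> as = replicate (arity S w) \<one>\<^bsub>H\<^esub>"
      using that(2) by (auto simp: tuples_def kernel_def intro!: replicate_eqI)
    then show "\<mu> (opn G w as) = \<one>\<^bsub>H\<^esub>"
      using that(1) as by (simp add: omega_homD(2)[OF \<mu>] H.opn_one)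
  qed
  show ?thesis unfolding omega_ideal_def
  proof (intro conjI ballI)
    show "omega_closed S (kernel G H \<mu>) G"
      using one by (simp add: omega_closed_def kernel_def)
    show "kernel G H \<mu> \<lhd> G" by (rule normal_kernel)
    fix w as bs assume w: "w \<in> ops S" and as: "as \<in> tuples (arity S w) (kernel G H \<mu>)"
      and bs: "bs \<in> tuples (arity S w) (carrier G)"
    let ?cs = "map2 (\<otimes>\<^bsub>G\<^esub>) as bs"
    have cs: "?cs \<in> tuples (arity S w) (carrier G)"
      using as bs by (force simp: tuples_def in_set_conv_nth kernel_def)
    have "map \<mu> ?cs = map \<mu> bs"
      using as bs by (intro nth_equalityI) (auto simp: tuples_def kernel_def subset_iff)
    then have "\<mu> (opn G w ?cs) = \<mu> (opn G w bs)"
      using omega_homD(2)[OF \<mu> w] bs cs by simp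
    then show "bracket G as bs w \<in> kernel G H \<mu>"
      using one[OF w as] G.opn_closed[OF w bs] G.opn_closed[OF w cs]
      by (simp add: bracket_def kernel_def)
  qed
qed

lemma omega_subgroup_image:
  assumes G: "omega_group S G" and H: "omega_group S H" and \<mu>: "\<mu> \<in> omega_hom S G H"
    and U: "omega_subgroup S U G"
  shows "omega_subgroup S (\<mu> ` U) H"
proof -
  interpret G: omega_group S G by fact
  interpret group_hom G H \<mu> by (rule omega_hom_group_hom) fact+
  have UG: "U \<subseteq> carrier G" using U by (simp add: omega_subgroup_def subgroup.subset)
  have "opn H w bs \<in> \<mu> ` U" if w: "w \<in> ops S" and bs: "bs \<in> tuples (arity S w) (\<mu> ` U)" for w bs
  proof -
    obtain as where as: "as \<in> tuples (arity S w) U" "bs = map \<mu> as" using tuples_image[OF bs] .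
    then show ?thesis
      using omega_homD(2)[OF \<mu> w tuples_mono[OF _ UG]] U w
      by (metis imageI omega_closed_def omega_subgroup_def)
  qed
  then show ?thesis
    using U subgroup_img_is_subgroup by (simp add: omega_subgroup_def omega_closed_def)
qed

lemma omega_ideal_image:
  assumes G: "omega_group S G" and H: "omega_group S H" and \<mu>: "\<mu> \<in> omega_hom S G H"
    and U: "omega_ideal S U G" and surj: "\<mu> ` carrier G = carrier H"
  shows "omega_ideal S (\<mu> ` U) H"
proof -
  interpret G: omega_group S G by fact
  interpret H: omega_group S H by fact
  interpret group_hom G H \<mu> by (rule omega_hom_group_hom) fact+
  interpret U: normal U G using U by (simp add: omega_ideal_def)
  note img = omega_subgroup_image[OF G H \<mu> G.omega_ideal_omega_subgroup[OF U]]
  show ?thesis unfolding omega_ideal_def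
  proof (intro conjI ballI)
    show "omega_closed S (\<mu> ` U) H" using img by (simp add: omega_subgroup_def)
    show "\<mu> ` U \<lhd> H"
      by (rule U.surj_hom_normal_subgroup[OF group_hom_axioms surj])
    fix w as bs assume w: "w \<in> ops S" and as: "as \<in> tuples (arity S w) (\<mu> ` U)"
      and bs: "bs \<in> tuples (arity S w) (carrier H)"
    obtain cs where cs: "cs \<in> tuples (arity S w) U" "as = map \<mu> cs" using tuples_image[OF as] .
    obtain ds where ds: "ds \<in> tuples (arity S w) (carrier G)" "bs = map \<mu> ds"
      using tuples_image[OF bs[folded surj]] .
    have cs': "cs \<in> tuples (arity S w) (carrier G)" using tuples_mono[OF cs(1) U.subset] .
    let ?es = "map2 (\<otimes>\<^bsub>G\<^esub>) cs ds"
    have es: "?es \<in> tuples (arity S w) (carrier G)"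
      using cs' ds(1) by (force simp: tuples_def in_set_conv_nth)
    have "map \<mu> ?es = map2 (\<otimes>\<^bsub>H\<^esub>) as bs"
      using cs' ds cs(2) by (intro nth_equalityI) (auto simp: tuples_def subset_iff)
    then have "bracket H as bs w = \<mu> (bracket G cs ds w)"
      using cs(2) ds(2) G.opn_closed[OF w cs'] G.opn_closed[OF w ds(1)] G.opn_closed[OF w es]
      by (simp add: bracket_def omega_homD(2)[OF \<mu> w cs'] omega_homD(2)[OF \<mu> w ds(1)]
          omega_homD(2)[OF \<mu> w es])
    moreover have "bracket G cs ds w \<in> U"
      using U w cs(1) ds(1) by (simp add: omega_ideal_def)
    ultimately show "bracket H as bs w \<in> \<mu> ` U" by simp
  qed
qed

section \<open>Commutator words and their values\<close>

context omega_group
begin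

lemma word_value_eval:
  assumes "v \<in> X \<rightarrow> carrier G" "s \<in> exprs S X"
  shows "word_value G v (free_rel S {} X `` {s}) = eval G v s"
  by (rule word_value_cls[OF arity_pos _ omega_group_in_variety[OF omega_group_axioms] assms])
    auto

lemma word_value_generator:
  assumes "v \<in> X \<rightarrow> carrier G" "x \<in> X"
  shows "word_value G v (generator S {} X x) = v x"
  unfolding generator_def using word_value_eval[OF assms(1) exprs.Var[OF assms(2)]] by simp

lemma word_value_omega_hom:
  assumes "v \<in> X \<rightarrow> carrier G"
  shows "restrict (word_value G v) (carrier (free_omega_group S {} X))
    \<in> omega_hom S (free_omega_group S {} X) G"
  by (rule free_universal(2)[OF arity_pos _ omega_group_in_variety[OF omega_group_axioms] assms])
    auto

lemma omega_group_free_words: "omega_group S (free_omega_group S {} X)"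
  by (rule omega_group_free[OF arity_pos]) auto

lemma generator_free_words: "x \<in> X \<Longrightarrow> generator S {} X x \<in> carrier (free_omega_group S {} X)"
  by (rule generator_free[OF arity_pos]) auto

lemma free_words_carrier:
  "f \<in> carrier (free_omega_group S {} X) \<longleftrightarrow> (\<exists>s \<in> exprs S X. f = free_rel S {} X `` {s})"
  by (rule free_carrier[OF arity_pos]) auto

lemma eval_one:
  assumes "s \<in> exprs S X"
  shows "eval G (\<lambda>_. \<one>) s = \<one>"
  using assms
proof induction
  case (App w ts)
  then have "map (eval G (\<lambda>_. \<one>)) ts = replicate (arity S w) \<one>"
    by (auto intro!: replicate_eqI)
  then show ?case using App opn_one by simp
qed auto

end

text \<open>Commutator words are classes of expressions; calculations are done with representatives.\<close>

definition commutator_expr :: "'w signature \<Rightarrow> nat \<Rightarrow> nat \<Rightarrow> (nat + nat, 'w) expr \<Rightarrow> bool" where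
  "commutator_expr S m n s \<longleftrightarrow>
     s \<in> exprs S (two_tuples m n) \<and> commutator_word S m n (free_rel S {} (two_tuples m n) `` {s})"

context omega_group
begin

text \<open>A commutator expression is recognized by the two values that it takes in one particular
  \<open>\<Omega>\<close>-group, the free one on its own variables.\<close>

lemma commutator_expr_iff:
  fixes m n
  defines "F \<equiv> free_omega_group S {} (two_tuples m n)"
    and "g \<equiv> generator S {} (two_tuples m n)"
  shows "commutator_expr S m n s \<longleftrightarrow> s \<in> exprs S (two_tuples m n) \<and>
    eval F (case_sum (\<lambda>i. g (Inl i)) (\<lambda>_. \<one>\<^bsub>F\<^esub>)) s = \<one>\<^bsub>F\<^esub> \<and>
    eval F (case_sum (\<lambda>_. \<one>\<^bsub>F\<^esub>) (\<lambda>j. g (Inr j))) s = \<one>\<^bsub>F\<^esub>"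
proof -
  let ?X = "two_tuples m n"
  interpret F: omega_group S F unfolding F_def by (rule omega_group_free_words)
  have "case_sum (\<lambda>i. g (Inl i)) (\<lambda>_. \<one>\<^bsub>F\<^esub>) \<in> ?X \<rightarrow> carrier F"
    "case_sum (\<lambda>_. \<one>\<^bsub>F\<^esub>) (\<lambda>j. g (Inr j)) \<in> ?X \<rightarrow> carrier F"
    unfolding F_def g_def by (auto intro!: generator_free_words F.one_closed[unfolded F_def])
  note val = this[THEN F.word_value_eval]
  have "free_rel S {} ?X `` {s} \<in> carrier F" if "s \<in> exprs S ?X"
    unfolding F_def using that free_words_carrier by blast
  then show ?thesis
    unfolding commutator_expr_def commutator_word_def Let_def F_def[symmetric] g_def[symmetric]
    using val by metis
qed

text \<open>A convenient sufficient condition: it suffices that the expression vanishes in the \<open>\<Omega>\<close>-groups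
  over the carrier type of the free one, which is among them.\<close>

lemma commutator_exprI:
  assumes s: "s \<in> exprs S (two_tuples m n)"
    and left: "\<And>(F :: ((nat + nat, 'w) expr set, 'w) ogroup) a.
      omega_group S F \<Longrightarrow> a \<in> {..<m} \<rightarrow> carrier F \<Longrightarrow> eval F (case_sum a (\<lambda>_. \<one>\<^bsub>F\<^esub>)) s = \<one>\<^bsub>F\<^esub>"
    and right: "\<And>(F :: ((nat + nat, 'w) expr set, 'w) ogroup) b.
      omega_group S F \<Longrightarrow> b \<in> {..<n} \<rightarrow> carrier F \<Longrightarrow> eval F (case_sum (\<lambda>_. \<one>\<^bsub>F\<^esub>) b) s = \<one>\<^bsub>F\<^esub>"
  shows "commutator_expr S m n s"
  unfolding commutator_expr_iff
  by (intro conjI s left right omega_group_free_words) (auto intro!: generator_free_words)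

text \<open>By the universal property, an expression that vanishes at the generators of the free
  \<open>\<Omega>\<close>-group, some of them replaced by \<open>0\<close>, vanishes under all assignments in \<open>G\<close> that are \<open>0\<close> at the
  same places.\<close>

lemma commutator_exprD:
  assumes s: "commutator_expr S m n s"
  shows "a \<in> {..<m} \<rightarrow> carrier G \<Longrightarrow> eval G (case_sum a (\<lambda>_. \<one>)) s = \<one>"
    and "b \<in> {..<n} \<rightarrow> carrier G \<Longrightarrow> eval G (case_sum (\<lambda>_. \<one>) b) s = \<one>"
proof -
  let ?X = "two_tuples m n" and ?F = "free_omega_group S {} (two_tuples m n)"
  let ?g = "generator S {} ?X"
  interpret F: omega_group S ?F by (rule omega_group_free_words)
  note s = s[unfolded commutator_expr_iff]
  have key: "eval G v s = \<one>"
    if u: "eval ?F u s = \<one>\<^bsub>?F\<^esub>" and v: "v \<in> ?X \<rightarrow> carrier G"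
      and uv: "\<And>x. x \<in> ?X \<Longrightarrow> u x = ?g x \<or> u x = \<one>\<^bsub>?F\<^esub> \<and> v x = \<one>" for u v
  proof -
    obtain \<mu> where \<mu>: "\<mu> \<in> omega_hom S ?F G" "\<And>x. x \<in> ?X \<Longrightarrow> \<mu> (?g x) = v x"
      using free_universal(1)[OF arity_pos _ omega_group_in_variety[OF omega_group_axioms] v]
      by auto
    interpret group_hom ?F G \<mu>
      by (rule omega_hom_group_hom[OF F.omega_group_axioms omega_group_axioms \<mu>(1)])
    have uF: "u \<in> ?X \<rightarrow> carrier ?F"
    proof
      fix x assume x: "x \<in> ?X"
      show "u x \<in> carrier ?F"
        using uv[OF x] generator_free_words[OF x] F.one_closed by metis
    qed
    have "v x = \<mu> (u x)" if "x \<in> ?X" for x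
      using uv[OF that] \<mu>(2)[OF that] hom_one by metis
    then have "eval G v s = eval G (\<lambda>x. \<mu> (u x)) s"
      by (rule eval_cong[OF s[THEN conjunct1]])
    also have "\<dots> = \<mu> (eval ?F u s)"
      using omega_hom_eval[OF F.omega_group_axioms omega_group_axioms \<mu>(1) uF] s by simp
    finally show ?thesis using u by simp
  qed
  show "eval G (case_sum a (\<lambda>_. \<one>)) s = \<one>" if "a \<in> {..<m} \<rightarrow> carrier G"
    by (rule key[OF s[THEN conjunct2, THEN conjunct1]]) (use that in auto)
  show "eval G (case_sum (\<lambda>_. \<one>) b) s = \<one>" if "b \<in> {..<n} \<rightarrow> carrier G"
    by (rule key[OF s[THEN conjunct2, THEN conjunct2]]) (use that in auto)
qed

lemma omega_commutator_eq:
  assumes "A \<subseteq> carrier G" "B \<subseteq> carrier G"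
  shows "omega_commutator S G A B =
    {eval G (case_sum a b) s |m n s a b.
       commutator_expr S m n s \<and> a \<in> {..<m} \<rightarrow> A \<and> b \<in> {..<n} \<rightarrow> B}"
proof -
  have val: "word_value G (case_sum a b) (free_rel S {} (two_tuples m n) `` {s}) = eval G (case_sum a b) s"
    if "s \<in> exprs S (two_tuples m n)" "a \<in> {..<m} \<rightarrow> A" "b \<in> {..<n} \<rightarrow> B" for m n s a b
    using that assms by (intro word_value_eval) (auto simp: Pi_iff)
  have ex: "\<exists>s. commutator_expr S m n s \<and> f = free_rel S {} (two_tuples m n) `` {s}"
    if "commutator_word S m n f" for m n f
  proof -
    have "f \<in> carrier (free_omega_group S {} (two_tuples m n))"
      using that by (simp add: commutator_word_def Let_def)
    then show ?thesis
      using that unfolding free_words_carrier commutator_expr_def by metis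
  qed
  show ?thesis
  proof
    show "omega_commutator S G A B \<subseteq> {eval G (case_sum a b) s |m n s a b.
       commutator_expr S m n s \<and> a \<in> {..<m} \<rightarrow> A \<and> b \<in> {..<n} \<rightarrow> B}"
    proof
      fix x assume "x \<in> omega_commutator S G A B"
      then obtain m n f a b where "commutator_word S m n f" and ab: "a \<in> {..<m} \<rightarrow> A" "b \<in> {..<n} \<rightarrow> B"
        and x: "x = word_value G (case_sum a b) f"
        unfolding omega_commutator_def by blast
      then obtain s where s: "commutator_expr S m n s"
        and f: "f = free_rel S {} (two_tuples m n) `` {s}" using ex by blast
      have "x = eval G (case_sum a b) s"
        unfolding x f by (rule val) (use s ab in \<open>auto simp: commutator_expr_def\<close>)
      then show "x \<in> {eval G (case_sum a b) s |m n s a b.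
          commutator_expr S m n s \<and> a \<in> {..<m} \<rightarrow> A \<and> b \<in> {..<n} \<rightarrow> B}"
        using s ab by blast
    qed
    show "{eval G (case_sum a b) s |m n s a b.
       commutator_expr S m n s \<and> a \<in> {..<m} \<rightarrow> A \<and> b \<in> {..<n} \<rightarrow> B} \<subseteq> omega_commutator S G A B"
    proof clarify
      fix m n s a b
      assume s: "commutator_expr S m n s" and ab: "a \<in> {..<m} \<rightarrow> A" "b \<in> {..<n} \<rightarrow> B"
      then have "eval G (case_sum a b) s
          = word_value G (case_sum a b) (free_rel S {} (two_tuples m n) `` {s})"
        by (intro val[symmetric]) (auto simp: commutator_expr_def)
      with s ab show "eval G (case_sum a b) s \<in> omega_commutator S G A B"
        unfolding omega_commutator_def commutator_expr_def by blast
    qed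
  qed
qed

lemma one_mem_omega_commutator:
  assumes "A \<subseteq> carrier G" "B \<subseteq> carrier G"
  shows "\<one> \<in> omega_commutator S G A B"
proof -
  have "commutator_expr S 0 0 Zero" by (rule commutator_exprI) (auto intro: exprs.Zero)
  then show ?thesis unfolding omega_commutator_eq[OF assms]
    by (intro CollectI exI[of _ "0::nat"] exI[of _ Zero]) auto
qed

lemma omega_commutator_mono:
  "A \<subseteq> A' \<Longrightarrow> B \<subseteq> B' \<Longrightarrow> omega_commutator S G A B \<subseteq> omega_commutator S G A' B'"
  unfolding omega_commutator_def by (fast intro: Pi_mono)

text \<open>Modulo \<open>U\<close>, the arguments from \<open>U\<close> may be replaced by \<open>0\<close>, which makes a commutator word
  vanish; the same holds for \<open>V\<close>.\<close>

lemma omega_commutator_ideals: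
  assumes U: "omega_ideal S U G" and V: "omega_ideal S V G"
  shows "omega_commutator S G U V \<subseteq> U \<inter> V"
proof
  interpret U: normal U G using U by (simp add: omega_ideal_def)
  interpret V: normal V G using V by (simp add: omega_ideal_def)
  fix x assume "x \<in> omega_commutator S G U V"
  then obtain m n s a b where s: "commutator_expr S m n s" and a: "a \<in> {..<m} \<rightarrow> U"
    and b: "b \<in> {..<n} \<rightarrow> V" and x: "x = eval G (case_sum a b) s"
    unfolding omega_commutator_eq[OF U.subset V.subset] by blast
  have sX: "s \<in> exprs S (two_tuples m n)" using s by (simp add: commutator_expr_def)
  have a': "a \<in> {..<m} \<rightarrow> carrier G" and b': "b \<in> {..<n} \<rightarrow> carrier G"
    using a b U.mem_carrier V.mem_carrier by (auto simp: Pi_iff)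
  have Ua: "U #> a i = U #> \<one>" if "i < m" for i
    using a that U.rcos_const[OF is_group] U.one_closed by auto
  have Vb: "V #> b j = V #> \<one>" if "j < n" for j
    using b that V.rcos_const[OF is_group] V.one_closed by auto
  have cl: "x \<in> carrier G" unfolding x
    by (rule eval_closed[OF omega_group_axioms _ sX]) (use a' b' in auto)
  have "U #> x = U #> eval G (case_sum (\<lambda>_. \<one>) b) s" unfolding x
    using a' b' Ua by (intro omega_ideal_eval_coset[OF U _ _ _ sX]) auto
  then have 1: "x \<in> U" using commutator_exprD(2)[OF s b'] cl rcos_self[OF cl U.subgroup_axioms] U.rcos_const[OF is_group U.one_closed] by simp
  have "V #> x = V #> eval G (case_sum a (\<lambda>_. \<one>)) s" unfolding x
    using a' b' Vb by (intro omega_ideal_eval_coset[OF V _ _ _ sX]) auto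
  then have "x \<in> V" using commutator_exprD(1)[OF s a'] cl rcos_self[OF cl V.subgroup_axioms] V.rcos_const[OF is_group V.one_closed] by simp
  with 1 show "x \<in> U \<inter> V" by simp
qed

lemma omega_commutator_omega_subgroup:
  assumes L: "omega_subgroup S L G" and "A \<subseteq> L" "B \<subseteq> L"
  shows "omega_commutator S (G\<lparr>carrier := L\<rparr>) A B = omega_commutator S G A B"
proof -
  interpret L: omega_group S "G\<lparr>carrier := L\<rparr>" by (rule omega_subgroup_omega_group[OF L])
  have LG: "L \<subseteq> carrier G" using L by (simp add: omega_subgroup_def subgroup.subset)
  have "eval (G\<lparr>carrier := L\<rparr>) (case_sum a b) s = eval G (case_sum a b) s"
    if "commutator_expr S m n s" "a \<in> {..<m} \<rightarrow> A" "b \<in> {..<n} \<rightarrow> B" for m n s a b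
    by (rule eval_omega_subgroup[OF L, where X = "two_tuples m n"])
      (use that assms(2,3) in \<open>auto simp: commutator_expr_def Pi_iff\<close>)
  moreover have "A \<subseteq> carrier (G\<lparr>carrier := L\<rparr>)" "B \<subseteq> carrier (G\<lparr>carrier := L\<rparr>)"
    "A \<subseteq> carrier G" "B \<subseteq> carrier G"
    using assms LG by auto
  ultimately show ?thesis
    by (simp only: L.omega_commutator_eq omega_commutator_eq) (metis (no_types, lifting))
qed

end

lemma omega_commutator_image:
  assumes G: "omega_group S G" and H: "omega_group S H" and \<mu>: "\<mu> \<in> omega_hom S G H"
    and A: "A \<subseteq> carrier G" and B: "B \<subseteq> carrier G"
  shows "\<mu> ` omega_commutator S G A B = omega_commutator S H (\<mu> ` A) (\<mu> ` B)"
proof -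
  interpret G: omega_group S G by fact
  interpret H: omega_group S H by fact
  interpret group_hom G H \<mu> by (rule omega_hom_group_hom) fact+
  have \<mu>AB: "\<mu> ` A \<subseteq> carrier H" "\<mu> ` B \<subseteq> carrier H" using A B by auto
  have hom: "\<mu> (eval G (case_sum a b) s) = eval H (case_sum (\<lambda>i. \<mu> (a i)) (\<lambda>j. \<mu> (b j))) s"
    if s: "commutator_expr S m n s" and a: "a \<in> {..<m} \<rightarrow> A" and b: "b \<in> {..<n} \<rightarrow> B" for m n s a b
  proof -
    have sX: "s \<in> exprs S (two_tuples m n)" using s by (simp add: commutator_expr_def)
    have "\<mu> (eval G (case_sum a b) s) = eval H (\<lambda>x. \<mu> (case_sum a b x)) s"
      by (rule omega_hom_eval[OF G H \<mu> _ sX]) (use a b A B in \<open>auto simp: Pi_iff\<close>)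
    also have "\<dots> = eval H (case_sum (\<lambda>i. \<mu> (a i)) (\<lambda>j. \<mu> (b j))) s"
      by (rule eval_cong[OF sX]) auto
    finally show ?thesis .
  qed
  show ?thesis
  proof
    show "\<mu> ` omega_commutator S G A B \<subseteq> omega_commutator S H (\<mu> ` A) (\<mu> ` B)"
      unfolding G.omega_commutator_eq[OF A B] H.omega_commutator_eq[OF \<mu>AB]
    proof clarify
      fix m n s a b
      assume *: "commutator_expr S m n s" "a \<in> {..<m} \<rightarrow> A" "b \<in> {..<n} \<rightarrow> B"
      show "\<exists>m' n' s' a' b'. \<mu> (eval G (case_sum a b) s) = eval H (case_sum a' b') s' \<and>
          commutator_expr S m' n' s' \<and> a' \<in> {..<m'} \<rightarrow> \<mu> ` A \<and> b' \<in> {..<n'} \<rightarrow> \<mu> ` B"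
        by (intro exI conjI, rule hom[OF *]) (use * in auto)
    qed
    show "omega_commutator S H (\<mu> ` A) (\<mu> ` B) \<subseteq> \<mu> ` omega_commutator S G A B"
      unfolding G.omega_commutator_eq[OF A B] H.omega_commutator_eq[OF \<mu>AB]
    proof clarify
      fix m n s a b
      assume *: "commutator_expr S m n s" "a \<in> {..<m} \<rightarrow> \<mu> ` A" "b \<in> {..<n} \<rightarrow> \<mu> ` B"
      have "\<forall>i \<in> {..<m}. \<exists>x \<in> A. a i = \<mu> x" "\<forall>j \<in> {..<n}. \<exists>x \<in> B. b j = \<mu> x" using * by auto
      then obtain a' b' where a': "\<forall>i \<in> {..<m}. a' i \<in> A \<and> a i = \<mu> (a' i)"
        and b': "\<forall>j \<in> {..<n}. b' j \<in> B \<and> b j = \<mu> (b' j)" by metis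
      have "eval H (case_sum a b) s = eval H (case_sum (\<lambda>i. \<mu> (a' i)) (\<lambda>j. \<mu> (b' j))) s"
        using *(1) a' b' by (intro eval_cong[of s S "two_tuples m n"]) (auto simp: commutator_expr_def)
      also have "\<dots> = \<mu> (eval G (case_sum a' b') s)"
        using a' b' by (intro hom[OF *(1), symmetric]) auto
      finally show "eval H (case_sum a b) s \<in> \<mu> ` {eval G (case_sum a b) s |m n s a b.
          commutator_expr S m n s \<and> a \<in> {..<m} \<rightarrow> A \<and> b \<in> {..<n} \<rightarrow> B}"
        using *(1) a' b' by (intro image_eqI) (assumption, blast)
    qed
  qed
qed

section \<open>Zero divisors and anticommutativity\<close>

definition zero_divisor_free :: "'w signature \<Rightarrow> ('a, 'w, 'm) ogroup_scheme \<Rightarrow> bool" where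
  "zero_divisor_free S G \<longleftrightarrow>
     (\<forall>a \<in> carrier G. \<forall>b \<in> carrier G.
        omega_commutator S G {a} {b} = {\<one>\<^bsub>G\<^esub>} \<longrightarrow> a = \<one>\<^bsub>G\<^esub> \<or> b = \<one>\<^bsub>G\<^esub>)"

lemma zero_divisor_freeD:
  assumes G: "omega_group S G" and zdf: "zero_divisor_free S G"
    and ab: "a \<in> carrier G" "b \<in> carrier G" and comm: "omega_commutator S G {a} {b} \<subseteq> {\<one>\<^bsub>G\<^esub>}"
  shows "a = \<one>\<^bsub>G\<^esub> \<or> b = \<one>\<^bsub>G\<^esub>"
proof -
  have "\<one>\<^bsub>G\<^esub> \<in> omega_commutator S G {a} {b}"
    using ab by (intro omega_group.one_mem_omega_commutator[OF G]) auto
  with comm have "omega_commutator S G {a} {b} = {\<one>\<^bsub>G\<^esub>}" by blast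
  with zdf ab show ?thesis unfolding zero_divisor_free_def by blast
qed

lemma zero_divisor_free_imp_C_anticommutative:
  assumes H: "omega_group S H" and zdf: "zero_divisor_free S H"
  shows "C_anticommutative S H"
  unfolding C_anticommutative_def
proof (intro allI impI, elim conjE)
  fix L assume L: "omega_subgroup S L H"
  interpret H: omega_group S H by fact
  let ?L = "H\<lparr>carrier := L\<rparr>"
  interpret L: omega_group S ?L by (rule H.omega_subgroup_omega_group[OF L])
  have LH: "L \<subseteq> carrier H" using L by (simp add: omega_subgroup_def subgroup.subset)
  have zero: "a = \<one>\<^bsub>H\<^esub> \<or> b = \<one>\<^bsub>H\<^esub>"
    if "a \<in> L" "b \<in> L" "omega_commutator S H {a} {b} \<subseteq> {\<one>\<^bsub>H\<^esub>}" for a b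
    using that LH by (intro zero_divisor_freeD[OF H zdf]) auto
  have nontriv: "\<exists>a \<in> U. a \<noteq> \<one>\<^bsub>H\<^esub>" and sub: "U \<subseteq> L" and subgrp: "omega_subgroup S U ?L"
    if "omega_ideal S U ?L" "U \<noteq> {\<one>\<^bsub>H\<^esub>}" for U
  proof -
    show *: "omega_subgroup S U ?L" using that L.omega_ideal_omega_subgroup by blast
    then have "\<one>\<^bsub>H\<^esub> \<in> U" by (auto simp: omega_subgroup_def dest: subgroup.one_closed)
    then show "\<exists>a \<in> U. a \<noteq> \<one>\<^bsub>H\<^esub>" using that by blast
    show "U \<subseteq> L" using * subgroup.subset[of U ?L] by (simp add: omega_subgroup_def)
  qed
  show "anticommutative S ?L"
    unfolding anticommutative_def
  proof (intro conjI notI allI impI; (elim exE conjE)?)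
    fix U assume U: "omega_ideal S U ?L" "U \<noteq> {\<one>\<^bsub>?L\<^esub>}" and ab: "abelian S (?L\<lparr>carrier := U\<rparr>)"
    then obtain a where a: "a \<in> U" "a \<noteq> \<one>\<^bsub>H\<^esub>" using nontriv[OF U(1)] by auto
    have U': "omega_subgroup S U ?L" "U \<subseteq> L" using subgrp sub U by auto
    have "omega_commutator S H {a} {a} = omega_commutator S ?L {a} {a}"
      using a U' by (intro H.omega_commutator_omega_subgroup[symmetric] L) auto
    also have "\<dots> \<subseteq> omega_commutator S ?L U U"
      using a by (intro L.omega_commutator_mono) auto
    also have "\<dots> = omega_commutator S (?L\<lparr>carrier := U\<rparr>) U U"
      using U' by (intro L.omega_commutator_omega_subgroup[symmetric]) auto
    also have "\<dots> = {\<one>\<^bsub>H\<^esub>}" using ab by (simp add: abelian_def)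
    finally show False using zero[of a a] a U'(2) by auto
  next
    fix U V
    assume U: "omega_ideal S U ?L" "U \<noteq> {\<one>\<^bsub>?L\<^esub>}" and V: "omega_ideal S V ?L" "V \<noteq> {\<one>\<^bsub>?L\<^esub>}"
      and triv: "U \<inter> V = {\<one>\<^bsub>?L\<^esub>}"
    obtain a b where ab: "a \<in> U" "a \<noteq> \<one>\<^bsub>H\<^esub>" "b \<in> V" "b \<noteq> \<one>\<^bsub>H\<^esub>"
      using nontriv[OF U(1)] nontriv[OF V(1)] U(2) V(2) by auto
    have "U \<subseteq> L" "V \<subseteq> L" using sub U V by auto
    then have "omega_commutator S H {a} {b} = omega_commutator S ?L {a} {b}"
      using ab by (intro H.omega_commutator_omega_subgroup[symmetric] L) auto
    also have "\<dots> \<subseteq> omega_commutator S ?L U V"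
      using ab by (intro L.omega_commutator_mono) auto
    also have "\<dots> \<subseteq> U \<inter> V" by (rule L.omega_commutator_ideals[OF U(1) V(1)])
    finally show False using zero[of a b] ab triv \<open>U \<subseteq> L\<close> \<open>V \<subseteq> L\<close> by auto
  qed
qed

text \<open>Ideals of \<open>L\<close> with vanishing commutator are obtained as images of ideals of the free
  \<open>\<Omega>\<close>-group \<open>F\<close>, where the intersection of the two ideals is known: it consists of the commutator
  words in two variables.\<close>

lemma C_anticommutative_imp_zero_divisor_free:
  assumes H: "omega_group S H" and C: "C_anticommutative S H"
  shows "zero_divisor_free S H"
  unfolding zero_divisor_free_def
proof (intro ballI impI, rule ccontr)
  interpret H: omega_group S H by fact
  fix a b assume a: "a \<in> carrier H" and b: "b \<in> carrier H"
    and comm: "omega_commutator S H {a} {b} = {\<one>\<^bsub>H\<^esub>}" and "\<not> (a = \<one>\<^bsub>H\<^esub> \<or> b = \<one>\<^bsub>H\<^esub>)"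
  then have ab: "a \<noteq> \<one>\<^bsub>H\<^esub>" "b \<noteq> \<one>\<^bsub>H\<^esub>" by auto
  define X where "X = two_tuples 1 1"
  let ?F = "free_omega_group S {} X"
  let ?g = "generator S {} X"
  let ?v = "case_sum (\<lambda>_. a) (\<lambda>_. b)"
  let ?vl = "case_sum (\<lambda>i. \<one>\<^bsub>?F\<^esub>) (\<lambda>j. ?g (Inr j))"
  let ?vr = "case_sum (\<lambda>i. ?g (Inl i)) (\<lambda>j. \<one>\<^bsub>?F\<^esub>)"
  interpret F: omega_group S ?F by (rule H.omega_group_free_words)
  have g: "?g x \<in> carrier ?F" if "x \<in> X" for x using H.generator_free_words that .
  have X_eq: "X = {Inl 0, Inr 0}" by (auto simp: X_def)
  have x: "Inl 0 \<in> X" "Inr 0 \<in> X" by (auto simp: X_eq)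
  define \<mu> where "\<mu> = restrict (word_value H ?v) (carrier ?F)"
  define L where "L = \<mu> ` carrier ?F"
  define K1 where "K1 = kernel ?F ?F (restrict (word_value ?F ?vl) (carrier ?F))"
  define K2 where "K2 = kernel ?F ?F (restrict (word_value ?F ?vr) (carrier ?F))"
  let ?L = "H\<lparr>carrier := L\<rparr>"
  have v: "?v \<in> X \<rightarrow> carrier H" and vl: "?vl \<in> X \<rightarrow> carrier ?F"
    and vr: "?vr \<in> X \<rightarrow> carrier ?F"
    using a b g[OF x(1)] g[OF x(2)] F.one_closed by (simp_all add: Pi_iff X_eq del: One_nat_def)
  have K: "omega_ideal S K1 ?F" "omega_ideal S K2 ?F"
    unfolding K1_def K2_def
    by (intro omega_ideal_kernel F.omega_group_axioms F.word_value_omega_hom vl vr)+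
  have KF: "K1 \<subseteq> carrier ?F" "K2 \<subseteq> carrier ?F"
    by (auto simp: K1_def K2_def kernel_def)
  have \<mu>: "\<mu> \<in> omega_hom S ?F H"
    unfolding \<mu>_def by (rule H.word_value_omega_hom[OF v])
  have L: "omega_subgroup S L H"
    unfolding L_def
    by (intro omega_subgroup_image[OF F.omega_group_axioms H \<mu>] F.omega_ideal_omega_subgroup
        F.omega_ideal_carrier)
  interpret L: omega_group S ?L by (rule H.omega_subgroup_omega_group[OF L])
  have \<mu>L: "\<mu> \<in> omega_hom S ?F ?L"
    using \<mu> by (auto simp: omega_hom_def hom_def L_def PiE_def)
  have ideals: "omega_ideal S (\<mu> ` K1) ?L" "omega_ideal S (\<mu> ` K2) ?L"
    by (intro omega_ideal_image[OF F.omega_group_axioms L.omega_group_axioms \<mu>L] K;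
        simp add: L_def)+
  have "?g (Inl 0) \<in> K1" "?g (Inr 0) \<in> K2"
    using g[OF x(1)] g[OF x(2)] F.word_value_generator[OF vl x(1)] F.word_value_generator[OF vr x(2)]
    by (simp_all add: K1_def K2_def kernel_def)
  moreover have "\<mu> (?g (Inl 0)) = a" "\<mu> (?g (Inr 0)) = b"
    using g[OF x(1)] g[OF x(2)] H.word_value_generator[OF v x(1)] H.word_value_generator[OF v x(2)]
    by (simp_all add: \<mu>_def)
  ultimately have mem: "a \<in> \<mu> ` K1" "b \<in> \<mu> ` K2" by (metis imageI)+
  have KL: "\<mu> ` K1 \<subseteq> L" "\<mu> ` K2 \<subseteq> L" using KF by (auto simp: L_def)
  \<comment> \<open>The two vanishing conditions defining \<open>K1\<close> and \<open>K2\<close> are literally those in the definition of a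
    commutator word.\<close>
  have "\<mu> f = \<one>\<^bsub>H\<^esub>" if f: "f \<in> K1 \<inter> K2" for f
  proof -
    have "f \<in> carrier ?F" using f KF by auto
    then have "commutator_word S 1 1 f"
      unfolding commutator_word_def Let_def X_def[symmetric]
      using f by (simp add: K1_def K2_def kernel_def)
    then have "word_value H ?v f \<in> omega_commutator S H {a} {b}"
      unfolding omega_commutator_def by blast
    then show ?thesis using comm \<open>f \<in> carrier ?F\<close> by (simp add: \<mu>_def)
  qed
  then have "\<mu> ` omega_commutator S ?F K1 K2 \<subseteq> {\<one>\<^bsub>H\<^esub>}"
    using F.omega_commutator_ideals[OF K] by blast
  then have AB: "omega_commutator S H (\<mu> ` K1) (\<mu> ` K2) \<subseteq> {\<one>\<^bsub>H\<^esub>}"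
    using omega_commutator_image[OF F.omega_group_axioms H \<mu> KF] by simp
  \<comment> \<open>Anticommutativity makes \<open>U\<close> a non-trivial ideal, but \<open>[U, U]\<close> is contained in the vanishing
    commutator of the two ideals.\<close>
  define U where "U = \<mu> ` K1 \<inter> \<mu> ` K2"
  have UL: "U \<subseteq> L" using KL by (auto simp: U_def)
  have U: "omega_ideal S U ?L" unfolding U_def by (rule L.omega_ideal_Int[OF ideals])
  have "L \<noteq> {\<one>\<^bsub>H\<^esub>}" using mem(1) KL ab by auto
  then have "anticommutative S ?L" using C L by (simp add: C_anticommutative_def)
  moreover have "\<mu> ` K1 \<noteq> {\<one>\<^bsub>?L\<^esub>}" "\<mu> ` K2 \<noteq> {\<one>\<^bsub>?L\<^esub>}" using mem ab by auto
  ultimately have "U \<noteq> {\<one>\<^bsub>?L\<^esub>}" and nab: "\<not> abelian S (?L\<lparr>carrier := U\<rparr>)"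
    using ideals U unfolding anticommutative_def U_def by blast+
  have Usub: "omega_subgroup S U ?L" using L.omega_ideal_omega_subgroup[OF U] .
  interpret U: omega_group S "?L\<lparr>carrier := U\<rparr>" by (rule L.omega_subgroup_omega_group[OF Usub])
  have "omega_commutator S (?L\<lparr>carrier := U\<rparr>) U U = omega_commutator S ?L U U"
    using UL by (intro L.omega_commutator_omega_subgroup[OF Usub]) auto
  also have "\<dots> = omega_commutator S H U U"
    using UL by (intro H.omega_commutator_omega_subgroup[OF L]) auto
  also have "\<dots> \<subseteq> omega_commutator S H (\<mu> ` K1) (\<mu> ` K2)"
    by (rule H.omega_commutator_mono) (auto simp: U_def)
  finally have "omega_commutator S (?L\<lparr>carrier := U\<rparr>) U U \<subseteq> {\<one>\<^bsub>H\<^esub>}" using AB by blast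
  then have "abelian S (?L\<lparr>carrier := U\<rparr>)"
    using U.one_mem_omega_commutator[of U U] by (auto simp: abelian_def)
  with nab show False ..
qed

section \<open>Zero divisors and unions of algebraic varieties\<close>

definition algebraic_set ::
  "'w signature \<Rightarrow> 'w identity set \<Rightarrow> 'x set \<Rightarrow> ('a, 'w, 'm) ogroup_scheme \<Rightarrow>
    ('x, 'w) expr set set \<Rightarrow> (('x, 'w) expr set \<Rightarrow> 'a) set" where
  "algebraic_set S E X H T =
    {\<mu> \<in> omega_hom S (free_omega_group S E X) H. T \<subseteq> kernel (free_omega_group S E X) H \<mu>}"

lemma algebraic_variety_iff:
  "algebraic_variety S E X H A \<longleftrightarrow>
    (\<exists>T \<subseteq> carrier (free_omega_group S E X). A = algebraic_set S E X H T)"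
  by (simp add: algebraic_variety_def algebraic_set_def)

lemma omega_commutator_one:
  assumes "omega_group S G"
  shows "omega_commutator S G {\<one>\<^bsub>G\<^esub>} (carrier G) \<subseteq> {\<one>\<^bsub>G\<^esub>}"
    and "omega_commutator S G (carrier G) {\<one>\<^bsub>G\<^esub>} \<subseteq> {\<one>\<^bsub>G\<^esub>}"
proof -
  interpret omega_group S G by fact
  show "omega_commutator S G {\<one>\<^bsub>G\<^esub>} (carrier G) \<subseteq> {\<one>\<^bsub>G\<^esub>}"
    "omega_commutator S G (carrier G) {\<one>\<^bsub>G\<^esub>} \<subseteq> {\<one>\<^bsub>G\<^esub>}"
    using omega_commutator_ideals omega_ideal_trivial omega_ideal_carrier by blast+
qed

text \<open>The commutator \<open>[T1, T2]\<close> takes the role of the product of two ideals of a polynomial ring.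
  It is formed in the free \<open>\<Omega>\<close>-group of the variety given by \<open>E\<close>, but with the commutator words of all
  \<open>\<Omega>\<close>-groups.\<close>

lemma algebraic_set_Un:
  assumes E: "E \<subseteq> identities S" and H: "omega_group S H" and zdf: "zero_divisor_free S H"
    and T1: "T1 \<subseteq> carrier (free_omega_group S E X)" and T2: "T2 \<subseteq> carrier (free_omega_group S E X)"
  shows "algebraic_set S E X H T1 \<union> algebraic_set S E X H T2
    = algebraic_set S E X H (omega_commutator S (free_omega_group S E X) T1 T2)"
proof -
  interpret H: omega_group S H by fact
  let ?F = "free_omega_group S E X"
  interpret F: omega_group S ?F by (rule omega_group_free[OF H.arity_pos E])
  have TF: "omega_commutator S ?F T1 T2 \<subseteq> carrier ?F"
    using F.omega_commutator_mono[OF T1 T2] F.omega_commutator_ideals[OF F.omega_ideal_carrier F.omega_ideal_carrier]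
    by blast
  have ker: "T \<subseteq> kernel ?F H \<mu> \<longleftrightarrow> \<mu> ` T \<subseteq> {\<one>\<^bsub>H\<^esub>}" if "T \<subseteq> carrier ?F" for T \<mu>
    using that by (auto simp: kernel_def)
  have "\<mu> ` T1 \<subseteq> {\<one>\<^bsub>H\<^esub>} \<or> \<mu> ` T2 \<subseteq> {\<one>\<^bsub>H\<^esub>} \<longleftrightarrow> \<mu> ` omega_commutator S ?F T1 T2 \<subseteq> {\<one>\<^bsub>H\<^esub>}"
    if \<mu>: "\<mu> \<in> omega_hom S ?F H" for \<mu>
  proof -
    interpret group_hom ?F H \<mu> by (rule omega_hom_group_hom[OF F.omega_group_axioms H \<mu>])
    note img = omega_commutator_image[OF F.omega_group_axioms H \<mu>]
    have \<mu>T: "\<mu> ` T1 \<subseteq> carrier H" "\<mu> ` T2 \<subseteq> carrier H" using T1 T2 by auto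
    show ?thesis
    proof
      assume "\<mu> ` T1 \<subseteq> {\<one>\<^bsub>H\<^esub>} \<or> \<mu> ` T2 \<subseteq> {\<one>\<^bsub>H\<^esub>}"
      then have "omega_commutator S H (\<mu> ` T1) (\<mu> ` T2) \<subseteq> {\<one>\<^bsub>H\<^esub>}"
        using H.omega_commutator_mono[OF _ \<mu>T(2), THEN subset_trans, OF _ omega_commutator_one(1)[OF H]]
          H.omega_commutator_mono[OF \<mu>T(1), THEN subset_trans, OF _ omega_commutator_one(2)[OF H]]
        by (rule disjE)
      then show "\<mu> ` omega_commutator S ?F T1 T2 \<subseteq> {\<one>\<^bsub>H\<^esub>}" by (simp only: img[OF T1 T2])
    next
      assume *: "\<mu> ` omega_commutator S ?F T1 T2 \<subseteq> {\<one>\<^bsub>H\<^esub>}"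
      have "\<mu> s = \<one>\<^bsub>H\<^esub> \<or> \<mu> t = \<one>\<^bsub>H\<^esub>" if "s \<in> T1" "t \<in> T2" for s t
      proof -
        have "omega_commutator S H {\<mu> s} {\<mu> t} \<subseteq> omega_commutator S H (\<mu> ` T1) (\<mu> ` T2)"
          using that by (intro H.omega_commutator_mono) auto
        also have "\<dots> \<subseteq> {\<one>\<^bsub>H\<^esub>}" using * by (simp add: img[OF T1 T2])
        finally have "omega_commutator S H {\<mu> s} {\<mu> t} \<subseteq> {\<one>\<^bsub>H\<^esub>}" .
        moreover have "\<mu> s \<in> carrier H" "\<mu> t \<in> carrier H" using \<mu>T that by auto
        ultimately show ?thesis
          by (intro zero_divisor_freeD[OF H zdf])
      qed
      then show "\<mu> ` T1 \<subseteq> {\<one>\<^bsub>H\<^esub>} \<or> \<mu> ` T2 \<subseteq> {\<one>\<^bsub>H\<^esub>}" by blast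
    qed
  qed
  then have "T1 \<subseteq> kernel ?F H \<mu> \<or> T2 \<subseteq> kernel ?F H \<mu>
      \<longleftrightarrow> omega_commutator S ?F T1 T2 \<subseteq> kernel ?F H \<mu>" if "\<mu> \<in> omega_hom S ?F H" for \<mu>
    using that by (simp only: ker[OF T1] ker[OF T2] ker[OF TF])
  then show ?thesis unfolding algebraic_set_def by auto
qed

lemma zero_divisor_free_imp_equational_domain:
  assumes E: "E \<subseteq> identities S" and H: "omega_group S H" and zdf: "zero_divisor_free S H"
  shows "equational_domain S E H"
  unfolding equational_domain_def
proof (intro allI impI)
  fix X :: "nat set" and A B
  assume "algebraic_variety S E X H A \<and> algebraic_variety S E X H B"
  then obtain T1 T2 where T: "T1 \<subseteq> carrier (free_omega_group S E X)"
      "T2 \<subseteq> carrier (free_omega_group S E X)"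
    and AB: "A = algebraic_set S E X H T1" "B = algebraic_set S E X H T2"
    unfolding algebraic_variety_iff by blast
  interpret H: omega_group S H by fact
  interpret F: omega_group S "free_omega_group S E X" by (rule omega_group_free[OF H.arity_pos E])
  have "omega_commutator S (free_omega_group S E X) T1 T2 \<subseteq> carrier (free_omega_group S E X)"
    using F.omega_commutator_mono[OF T]
      F.omega_commutator_ideals[OF F.omega_ideal_carrier F.omega_ideal_carrier] by blast
  then show "algebraic_variety S E X H (A \<union> B)"
    unfolding algebraic_variety_iff AB algebraic_set_Un[OF E H zdf T] by blast
qed

text \<open>The expression \<open>- s(x, 0) + s(x, y) - s(0, y)\<close>, where the variables \<open>0\<close> and \<open>1\<close> of \<open>s\<close> are
  renamed to \<open>x = Inl 0\<close> and \<open>y = Inr 0\<close>.\<close>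

definition commutator_of :: "(nat, 'w) expr \<Rightarrow> (nat + nat, 'w) expr" where
  "commutator_of s = Add
    (Add (Neg (subst (\<lambda>i. if i = 0 then Var (Inl 0) else Zero) s))
      (subst (\<lambda>i. if i = 0 then Var (Inl 0) else Var (Inr 0)) s))
    (Neg (subst (\<lambda>i. if i = 0 then Zero else Var (Inr 0)) s))"

lemma eval_commutator_of:
  "eval G v (commutator_of s) =
    inv\<^bsub>G\<^esub> (eval G (\<lambda>i. if i = 0 then v (Inl 0) else \<one>\<^bsub>G\<^esub>) s) \<otimes>\<^bsub>G\<^esub>
    eval G (\<lambda>i. if i = 0 then v (Inl 0) else v (Inr 0)) s \<otimes>\<^bsub>G\<^esub>
    inv\<^bsub>G\<^esub> (eval G (\<lambda>i. if i = 0 then \<one>\<^bsub>G\<^esub> else v (Inr 0)) s)"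
  by (simp add: commutator_of_def eval_subst if_distrib[of "eval G v"] cong: if_cong)

text \<open>For \<open>y = 0\<close> the first two summands cancel and for \<open>x = 0\<close> the last two; what remains is
  \<open>- s(0, 0)\<close>, which is \<open>0\<close> because the operations preserve \<open>0\<close>.\<close>

lemma commutator_expr_commutator_of:
  assumes G: "omega_group S G" and s: "s \<in> exprs S {0, 1}"
  shows "commutator_expr S 1 1 (commutator_of s)"
proof (rule omega_group.commutator_exprI[OF G])
  show "commutator_of s \<in> exprs S (two_tuples 1 1)"
    unfolding commutator_of_def
    by (intro exprs.Add exprs.Neg subst_closed[OF s]) (auto intro: exprs.intros)
next
  fix F :: "((nat + nat, 'a) expr set, 'a) ogroup" and a
  assume F: "omega_group S F" and a: "a \<in> {..<1::nat} \<rightarrow> carrier F"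
  interpret F: omega_group S F by fact
  have "eval F (\<lambda>i. if i = 0 then a 0 else \<one>\<^bsub>F\<^esub>) s \<in> carrier F"
    by (rule eval_closed[OF F _ s]) (use a in auto)
  then show "eval F (case_sum a (\<lambda>_. \<one>\<^bsub>F\<^esub>)) (commutator_of s) = \<one>\<^bsub>F\<^esub>"
    by (simp add: eval_commutator_of F.eval_one[OF s] cong: if_cong)
next
  fix F :: "((nat + nat, 'a) expr set, 'a) ogroup" and b
  assume F: "omega_group S F" and b: "b \<in> {..<1::nat} \<rightarrow> carrier F"
  interpret F: omega_group S F by fact
  have "eval F (\<lambda>i. if i = 0 then \<one>\<^bsub>F\<^esub> else b 0) s \<in> carrier F"
    by (rule eval_closed[OF F _ s]) (use b in auto)
  then show "eval F (case_sum (\<lambda>_. \<one>\<^bsub>F\<^esub>) b) (commutator_of s) = \<one>\<^bsub>F\<^esub>"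
    by (simp add: eval_commutator_of F.eval_one[OF s] cong: if_cong)
qed

text \<open>The two coordinate axes are algebraic varieties, so their union is defined by a set \<open>T\<close> of words.
  These words need not be commutator words: they vanish on the axes of \<open>H\<close>, perhaps not on those of
  every \<open>\<Omega>\<close>-group.  Passing to \<open>commutator_of\<close> repairs this without changing the value at \<open>(a, b)\<close>.\<close>

lemma equational_domain_imp_zero_divisor_free:
  fixes H :: "('a, 'w, 'm) ogroup_scheme"
  assumes E: "E \<subseteq> identities S" and HE: "in_variety S E H" and eqd: "equational_domain S E H"
  shows "zero_divisor_free S H"
  unfolding zero_divisor_free_def
proof (intro ballI impI)
  fix a b assume a: "a \<in> carrier H" and b: "b \<in> carrier H"
    and comm: "omega_commutator S H {a} {b} = {\<one>\<^bsub>H\<^esub>}"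
  have H: "omega_group S H" using HE by (simp add: in_variety_def)
  interpret H: omega_group S H by fact
  let ?X = "{0, 1} :: nat set"
  let ?F = "free_omega_group S E ?X"
  let ?g = "generator S E ?X"
  define val where "val x y = (\<lambda>i::nat. if i = 0 then x else y)" for x y :: 'a
  define \<mu> where "\<mu> x y = restrict (word_value H (val x y)) (carrier ?F)" for x y
  have vcl: "val x y \<in> ?X \<rightarrow> carrier H" if "x \<in> carrier H" "y \<in> carrier H" for x y
    using that by (auto simp: val_def)
  have \<mu>: "\<mu> x y \<in> omega_hom S ?F H" if "x \<in> carrier H" "y \<in> carrier H" for x y
    unfolding \<mu>_def by (rule free_universal(2)[OF H.arity_pos E HE vcl[OF that]])
  have cls: "free_rel S E ?X `` {s} \<in> carrier ?F" if "s \<in> exprs S ?X" for s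
    using that free_carrier[OF H.arity_pos E] by blast
  have \<mu>_cls: "\<mu> x y (free_rel S E ?X `` {s}) = eval H (val x y) s"
    if "x \<in> carrier H" "y \<in> carrier H" "s \<in> exprs S ?X" for x y s
    using word_value_cls[OF H.arity_pos E HE vcl[OF that(1,2)] that(3)] cls[OF that(3)]
    by (simp add: \<mu>_def)
  have gF: "?g i \<in> carrier ?F" if "i \<in> ?X" for i
    by (rule generator_free[OF H.arity_pos E that])
  have \<mu>_g: "\<mu> x y (?g i) = val x y i"
    if "x \<in> carrier H" "y \<in> carrier H" "i \<in> ?X" for x y i
    unfolding generator_def using \<mu>_cls[OF that(1,2) exprs.Var[OF that(3)]] by simp
  let ?A = "algebraic_set S E ?X H {?g 0}" and ?B = "algebraic_set S E ?X H {?g 1}"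
  have mem: "\<mu> x y \<in> ?A \<union> ?B \<longleftrightarrow> x = \<one>\<^bsub>H\<^esub> \<or> y = \<one>\<^bsub>H\<^esub>"
    if "x \<in> carrier H" "y \<in> carrier H" for x y
    using \<mu>[OF that] \<mu>_g[OF that] gF by (auto simp: algebraic_set_def kernel_def val_def)
  have "algebraic_variety S E ?X H (algebraic_set S E ?X H {?g i})" if "i \<in> ?X" for i
    unfolding algebraic_variety_iff by (rule exI[of _ "{?g i}"]) (use gF[OF that] in simp)
  from this[of 0] this[of 1] have "algebraic_variety S E ?X H ?A" "algebraic_variety S E ?X H ?B"
    by simp_all
  then have "algebraic_variety S E ?X H (?A \<union> ?B)"
    using eqd unfolding equational_domain_def by (meson finite.emptyI finite.insertI)
  then obtain T where T: "T \<subseteq> carrier ?F" and AB: "?A \<union> ?B = algebraic_set S E ?X H T"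
    unfolding algebraic_variety_iff by blast
  have "\<mu> a b f = \<one>\<^bsub>H\<^esub>" if f: "f \<in> T" for f
  proof -
    obtain s where s: "s \<in> exprs S ?X" and fs: "f = free_rel S E ?X `` {s}"
      using f T free_carrier[OF H.arity_pos E] by blast
    have "eval H (val x y) s = \<one>\<^bsub>H\<^esub>"
      if xy: "x \<in> carrier H" "y \<in> carrier H" "x = \<one>\<^bsub>H\<^esub> \<or> y = \<one>\<^bsub>H\<^esub>" for x y
    proof -
      have "\<mu> x y \<in> algebraic_set S E ?X H T" using mem[OF xy(1,2)] xy(3) AB by blast
      then have "\<mu> x y f = \<one>\<^bsub>H\<^esub>" using f by (auto simp: algebraic_set_def kernel_def)
      then show ?thesis using \<mu>_cls[OF xy(1,2) s] fs by simp
    qed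
    from this[of a "\<one>\<^bsub>H\<^esub>"] this[of "\<one>\<^bsub>H\<^esub>" b]
    have zero: "eval H (val a \<one>\<^bsub>H\<^esub>) s = \<one>\<^bsub>H\<^esub>" "eval H (val \<one>\<^bsub>H\<^esub> b) s = \<one>\<^bsub>H\<^esub>"
      using a b by auto
    have "eval H (val a b) s \<in> carrier H" by (rule eval_closed[OF H vcl[OF a b] s])
    then have "eval H (val a b) s = eval H (case_sum (\<lambda>_. a) (\<lambda>_. b)) (commutator_of s)"
      using zero by (simp add: eval_commutator_of val_def cong: if_cong)
    also have "\<dots> \<in> omega_commutator S H {a} {b}"
    proof -
      have sub: "{a} \<subseteq> carrier H" "{b} \<subseteq> carrier H" using a b by auto
      show ?thesis
        unfolding H.omega_commutator_eq[OF sub]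
        using commutator_expr_commutator_of[OF H s] by blast
    qed
    finally show ?thesis using comm \<mu>_cls[OF a b s] fs by simp
  qed
  then have "T \<subseteq> kernel ?F H (\<mu> a b)" using T by (auto simp: kernel_def)
  then have "\<mu> a b \<in> ?A \<union> ?B" unfolding AB using \<mu>[OF a b] by (simp add: algebraic_set_def)
  then show "a = \<one>\<^bsub>H\<^esub> \<or> b = \<one>\<^bsub>H\<^esub>" using mem[OF a b] by simp
qed

section \<open>The characterization of equational domains\<close>

theorem proposition2p4:
  fixes S :: "'w signature" and \<Theta> :: "'w identity set" and H :: "('a, 'w) ogroup"
  assumes "\<Theta> \<subseteq> identities S"
    and "in_variety S \<Theta> H"
    and "carrier H \<noteq> {\<one>\<^bsub>H\<^esub>}"
  shows "equational_domain S \<Theta> H \<longleftrightarrow> C_anticommutative S H"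
proof -
  have H: "omega_group S H" using assms(2) by (simp add: in_variety_def)
  show ?thesis
    using equational_domain_imp_zero_divisor_free[OF assms(1,2)]
      zero_divisor_free_imp_equational_domain[OF assms(1) H]
      zero_divisor_free_imp_C_anticommutative[OF H] C_anticommutative_imp_zero_divisor_free[OF H]
    by blast
qed

end
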